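(* Let $X$ be a complex Banach space and let $(T(t))_{t\geq 0}$ be a differentiable $C_0$ semigroup on $X$ with infinitesimal generator $A$. Then for every $t>0$ and every $\sigma_{*}\in\{\sigma_{uf},\sigma_{lf},\sigma_{e},\sigma_{ub},\sigma_{lb},\sigma_{b}\}$, $$\sigma_{*}(T(t))\setminus\{0\}=\{e^{\lambda t} : \lambda\in\sigma_{*}(A)\}.$$
   Context: A $C_0$ semigroup $(T(t))_{t\ge 0}$ is differentiable if for every $x\in X$ the map $t\mapsto T(t)x$ is differentiable for $t>0$. For a closed linear operator $S$ on $X$ with domain $D(S)$, $N(S)$ is its null space and $R(S)$ its range. $S$ is upper semi-Fredholm if $\dim N(S)<\infty$ and $R(S)$ is closed; lower semi-Fredholm if $\operatorname{codim} R(S)<\infty$; Fredholm if it is both. The ascent of $S$ is $\operatorname{asc}(S)=\inf\{n\in\mathbb{N}: N(S^n)=N(S^{n+1})\}$ and the descent is $\operatorname{des}(S)=\inf\{n\in\mathbb{N}: R(S^n)=R(S^{n+1})\}$, with $\inf\emptyset=\infty$. $S$ is upper semi-Browder if it is upper semi-Fredholm with finite ascent, lower semi-Browder if it is lower semi-Fredholm with finite descent, and Browder if it is both. The spectra $\sigma_{uf}(S),\sigma_{lf}(S),\sigma_e(S),\sigma_{ub}(S),\sigma_{lb}(S),\sigma_b(S)$ are the sets of $\lambda\in\mathbb{C}$ such that $S-\lambda I$ is not upper semi-Fredholm, not lower semi-Fredholm, not Fredholm, not upper semi-Browder, not lower semi-Browder, not Browder, respectively. *)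

theory Defs
  imports "HOL-Analysis.Analysis" "HOL-Library.Extended_Nat"
begin

class complex_banach = banach +
  fixes scaleC :: "complex \<Rightarrow> 'a \<Rightarrow> 'a"  (infixr \<open>*\<^sub>C\<close> 75)
  assumes scaleC_add_right: "a *\<^sub>C (x + y) = a *\<^sub>C x + a *\<^sub>C y"
    and scaleC_add_left: "(a + b) *\<^sub>C x = a *\<^sub>C x + b *\<^sub>C x"
    and scaleC_scaleC: "a *\<^sub>C b *\<^sub>C x = (a * b) *\<^sub>C x"
    and scaleC_one: "1 *\<^sub>C x = x"
    and scaleR_scaleC: "r *\<^sub>R x = of_real r *\<^sub>C x"
    and norm_scaleC: "norm (a *\<^sub>C x) = cmod a * norm x"

global_interpretation complex_vector:
  vector_space "scaleC :: complex \<Rightarrow> 'a \<Rightarrow> 'a::complex_banach"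
  by unfold_locales (simp_all add: scaleC_add_right scaleC_add_left scaleC_scaleC scaleC_one)

instantiation complex :: complex_banach
begin

definition scaleC_complex :: "complex \<Rightarrow> complex \<Rightarrow> complex"
  where "scaleC_complex = (*)"

instance
  by standard
    (simp_all add: scaleC_complex_def algebra_simps norm_mult scaleR_conv_of_real)

end

definition finite_dimensional :: "'a::complex_banach set \<Rightarrow> bool"
  where "finite_dimensional V \<longleftrightarrow> (\<exists>B. finite B \<and> V = complex_vector.span B)"

(* For a subspace R: the quotient X/R is spanned by the classes of finitely many vectors. *)
definition finite_codimensional :: "'a::complex_banach set \<Rightarrow> bool"
  where "finite_codimensional R \<longleftrightarrow>
    (\<exists>B. finite B \<and> (\<forall>x. \<exists>r\<in>R. x - r \<in> complex_vector.span B))"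

(* A possibly unbounded linear operator is represented by its graph, so that its domain is
   Domain S, its range is Range S, and S ^^ n is its n-th power with the usual domain
   D(S^n) = {x : x, S x, ..., S^(n-1) x in D(S)}; in particular S ^^ 0 = Id. *)
type_synonym 'a operator = "('a \<times> 'a) set"

definition op_graph :: "('a \<Rightarrow> 'a) \<Rightarrow> 'a operator"
  where "op_graph f = {(x, f x) | x. True}"

definition null_space :: "'a::zero operator \<Rightarrow> 'a set"
  where "null_space S = {x. (x, 0) \<in> S}"

definition shift :: "'a::complex_banach operator \<Rightarrow> complex \<Rightarrow> 'a operator"
  where "shift S l = {(x, y - l *\<^sub>C x) | x y. (x, y) \<in> S}"

definition ascent :: "'a::zero operator \<Rightarrow> enat"
  where "ascent S = Inf {enat n | n. null_space (S ^^ n) = null_space (S ^^ (n + 1))}"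

definition descent :: "'a operator \<Rightarrow> enat"
  where "descent S = Inf {enat n | n. Range (S ^^ n) = Range (S ^^ (n + 1))}"

definition upper_semi_Fredholm :: "'a::complex_banach operator \<Rightarrow> bool"
  where "upper_semi_Fredholm S \<longleftrightarrow> finite_dimensional (null_space S) \<and> closed (Range S)"

definition lower_semi_Fredholm :: "'a::complex_banach operator \<Rightarrow> bool"
  where "lower_semi_Fredholm S \<longleftrightarrow> finite_codimensional (Range S)"

definition Fredholm :: "'a::complex_banach operator \<Rightarrow> bool"
  where "Fredholm S \<longleftrightarrow> upper_semi_Fredholm S \<and> lower_semi_Fredholm S"

definition upper_semi_Browder :: "'a::complex_banach operator \<Rightarrow> bool"
  where "upper_semi_Browder S \<longleftrightarrow> upper_semi_Fredholm S \<and> ascent S < \<infinity>"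

definition lower_semi_Browder :: "'a::complex_banach operator \<Rightarrow> bool"
  where "lower_semi_Browder S \<longleftrightarrow> lower_semi_Fredholm S \<and> descent S < \<infinity>"

definition Browder :: "'a::complex_banach operator \<Rightarrow> bool"
  where "Browder S \<longleftrightarrow> upper_semi_Browder S \<and> lower_semi_Browder S"

definition sigma_uf :: "'a::complex_banach operator \<Rightarrow> complex set"
  where "sigma_uf S = {l. \<not> upper_semi_Fredholm (shift S l)}"

definition sigma_lf :: "'a::complex_banach operator \<Rightarrow> complex set"
  where "sigma_lf S = {l. \<not> lower_semi_Fredholm (shift S l)}"

definition sigma_e :: "'a::complex_banach operator \<Rightarrow> complex set"
  where "sigma_e S = {l. \<not> Fredholm (shift S l)}"

definition sigma_ub :: "'a::complex_banach operator \<Rightarrow> complex set"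
  where "sigma_ub S = {l. \<not> upper_semi_Browder (shift S l)}"

definition sigma_lb :: "'a::complex_banach operator \<Rightarrow> complex set"
  where "sigma_lb S = {l. \<not> lower_semi_Browder (shift S l)}"

definition sigma_b :: "'a::complex_banach operator \<Rightarrow> complex set"
  where "sigma_b S = {l. \<not> Browder (shift S l)}"

definition bounded_clinear :: "('a::complex_banach \<Rightarrow> 'a) \<Rightarrow> bool"
  where "bounded_clinear f \<longleftrightarrow> bounded_linear f \<and> (\<forall>c x. f (c *\<^sub>C x) = c *\<^sub>C f x)"

(* T is only meaningful at nonnegative times; its values at negative reals are unconstrained. *)
definition C0_semigroup :: "(real \<Rightarrow> 'a::complex_banach \<Rightarrow> 'a) \<Rightarrow> bool"
  where "C0_semigroup T \<longleftrightarrow>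
    (\<forall>t\<ge>0. bounded_clinear (T t)) \<and>
    (\<forall>x. T 0 x = x) \<and>
    (\<forall>s\<ge>0. \<forall>t\<ge>0. \<forall>x. T (s + t) x = T s (T t x)) \<and>
    (\<forall>x. ((\<lambda>t. T t x) \<longlongrightarrow> x) (at_right 0))"

definition differentiable_semigroup :: "(real \<Rightarrow> 'a::complex_banach \<Rightarrow> 'a) \<Rightarrow> bool"
  where "differentiable_semigroup T \<longleftrightarrow>
    C0_semigroup T \<and> (\<forall>x. \<forall>t>0. (\<lambda>s. T s x) differentiable (at t))"

definition generator :: "(real \<Rightarrow> 'a::complex_banach \<Rightarrow> 'a) \<Rightarrow> 'a operator"
  where "generator T = {(x, y). ((\<lambda>h. (T h x - x) /\<^sub>R h) \<longlongrightarrow> y) (at_right 0)}"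

end

theory Submission
  imports Defs
begin

text \<open>
  For \<open>exp (l t) = \<mu>\<close> the operator \<open>T t - \<mu>\<close> factors as \<open>(A - l) B\<^sub>l\<close>, where \<open>B\<^sub>l\<close> is a bounded operator
  (a multiple of the integral of \<open>exp (- l s) T s\<close> over \<open>[0, t]\<close>) commuting with \<open>A\<close>, and \<open>A - l\<close> and \<open>B\<^sub>l\<close> are
  coprime: \<open>(A - l) C\<^sub>l + c B\<^sub>l = 1\<close>. This alone carries every Fredholm and Browder property from \<open>T t - \<mu>\<close>
  to \<open>A - l\<close>. The converse rests on a Bezout identity \<open>1 = (\<Sum>l. B\<^sub>l Q\<^sub>l) + (T t - \<mu>) V\<close> with
  finitely many \<open>l\<close> and commuting bounded operators. Differentiability makes \<open>A T t\<close> bounded, so \<open>B\<^sub>l\<close> is a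
  multiple of \<open>T t - \<mu>\<close> for all but finitely many \<open>l\<close>; and the \<open>B\<^sub>l\<close> are the Fourier coefficients of the orbit
  over a period, from which a concentrating trigonometric kernel reconstructs an invertible operator
  modulo \<open>T t - \<mu>\<close>.
\<close>

text \<open>Infinitely many \<open>l\<close> solve \<open>exp (l t) = \<mu>\<close>, and what is
  known about each \<open>A - l\<close> separately gives no bound over the whole fibre; this is why
  the identity has to involve only finitely many of them. The second obstacle is the topology. The
  reconstruction is a Fejer-type summation, and inverting its result by a Neumann argument needs
  convergence in operator norm, whereas a C0 semigroup is in general only strongly continuous at
  time 0. At positive times differentiability makes it locally Lipschitz in norm, so the summation
  is done on an orbit shifted away from 0. The shift \<open>3 t / 2\<close> sends the centre
  \<open>t / 2\<close> of the kernel to \<open>2 t\<close>, a multiple of the period, where the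
  semigroup is a scalar modulo \<open>T t - \<mu>\<close>. Finally, an ideal that contains an
  invertible element contains 1 only if the inverse lies in the same commutative algebra. The
  commutant of the semigroup need not be commutative, hence the bicommutant.\<close>

section \<open>Bounded complex-linear maps and finite-dimensional subspaces\<close>

lemma bounded_bilinear_scaleC:
  "bounded_bilinear (scaleC :: complex \<Rightarrow> 'a::complex_banach \<Rightarrow> 'a)"
proof
  show "\<exists>K. \<forall>a (b::'a). norm (a *\<^sub>C b) \<le> norm a * norm b * K"
    by (intro exI[of _ 1]) (simp add: norm_scaleC)
qed (simp_all add: scaleC_add_left scaleC_add_right scaleR_scaleC scaleC_scaleC
      scaleR_conv_of_real scaleC_complex_def mult_ac)

interpretation scaleC: bounded_bilinear "scaleC :: complex \<Rightarrow> 'a::complex_banach \<Rightarrow> 'a"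
  by (rule bounded_bilinear_scaleC)

lemma bounded_clinear_imp_bounded_linear: "bounded_clinear f \<Longrightarrow> bounded_linear f"
  by (simp add: bounded_clinear_def)

lemma bounded_clinear_scaleC: "bounded_clinear f \<Longrightarrow> f (c *\<^sub>C x) = c *\<^sub>C f x"
  by (simp add: bounded_clinear_def)

lemmas bounded_clinear_add = bounded_linear.linear[OF bounded_clinear_imp_bounded_linear, THEN linear_add]
lemmas bounded_clinear_diff = bounded_linear.linear[OF bounded_clinear_imp_bounded_linear, THEN linear_diff]
lemmas bounded_clinear_sum = bounded_linear.linear[OF bounded_clinear_imp_bounded_linear, THEN linear_sum]
lemmas bounded_clinear_0 = bounded_linear.linear[OF bounded_clinear_imp_bounded_linear, THEN linear_0]
lemmas bounded_clinear_minus = bounded_linear.linear[OF bounded_clinear_imp_bounded_linear, THEN linear_neg]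

lemmas bounded_clinear_simps =
  bounded_clinear_add bounded_clinear_diff bounded_clinear_0 bounded_clinear_minus
  bounded_clinear_scaleC bounded_clinear_sum

lemma bounded_clinear_ident: "bounded_clinear (\<lambda>x. x)"
  by (simp add: bounded_clinear_def bounded_linear_ident)

lemma bounded_clinear_compose:
  "bounded_clinear f \<Longrightarrow> bounded_clinear g \<Longrightarrow> bounded_clinear (\<lambda>x. f (g x))"
  by (simp add: bounded_clinear_def bounded_linear_compose)

lemma bounded_clinear_scaleC_right:
  "bounded_clinear f \<Longrightarrow> bounded_clinear (\<lambda>x. c *\<^sub>C f x)"
  by (auto simp: bounded_clinear_def scaleC_scaleC mult.commute
      intro: bounded_linear_compose[OF scaleC.bounded_linear_right])

lemma bounded_clinear_plus:
  "bounded_clinear f \<Longrightarrow> bounded_clinear g \<Longrightarrow> bounded_clinear (\<lambda>x. f x + g x)"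
  by (simp add: bounded_clinear_def scaleC_add_right bounded_linear_add)

lemma bounded_clinear_funpow: "bounded_clinear f \<Longrightarrow> bounded_clinear (f ^^ n)"
  by (induction n) (simp_all add: id_def o_def bounded_clinear_ident bounded_clinear_compose)

lemma bounded_clinear_span:
  assumes "bounded_clinear f" and "x \<in> complex_vector.span X"
  shows "f x \<in> complex_vector.span (f ` X)"
  using assms(2)
proof (induction rule: complex_vector.span_induct_alt)
  case base
  then show ?case
    by (simp add: bounded_clinear_0[OF assms(1)] complex_vector.span_zero)
next
  case (step c x y)
  then show ?case
    by (simp add: bounded_clinear_add[OF assms(1)] bounded_clinear_scaleC[OF assms(1)]
        complex_vector.span_add complex_vector.span_scale complex_vector.span_base)
qed

lemma finite_dimensional_subspace:
  assumes W: "finite W" "V \<subseteq> complex_vector.span W" and V: "complex_vector.subspace V"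
  shows "finite_dimensional V"
proof -
  obtain B where B: "B \<subseteq> V" "complex_vector.independent B" "V \<subseteq> complex_vector.span B"
    using complex_vector.maximal_independent_subset[of V] by metis
  have "finite B"
    using complex_vector.independent_span_bound[OF W(1) B(2)] B(1) W(2) by auto
  moreover have "V = complex_vector.span B"
    using B complex_vector.span_minimal[OF B(1) V] by blast
  ultimately show ?thesis
    by (auto simp: finite_dimensional_def)
qed

section \<open>Powers of linear relations\<close>

lemma relpow_map:
  assumes "\<And>x y. (x, y) \<in> S \<Longrightarrow> (f x, f y) \<in> S" and "(x, y) \<in> S ^^ n"
  shows "(f x, f y) \<in> S ^^ n"
  using assms(2)
proof (induction n arbitrary: y)
  case (Suc n)
  then show ?case using assms(1) by (auto intro!: relpow_Suc_I elim!: relpow_Suc_E)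
qed auto

lemma relpow_map2:
  assumes "\<And>x y x' y'. (x, y) \<in> S \<Longrightarrow> (x', y') \<in> S \<Longrightarrow> (g x x', g y y') \<in> S"
    and "(x, y) \<in> S ^^ n" and "(x', y') \<in> S ^^ n"
  shows "(g x x', g y y') \<in> S ^^ n"
  using assms(2,3)
proof (induction n arbitrary: y y')
  case (Suc n)
  then show ?case using assms(1) by (auto intro!: relpow_Suc_I elim!: relpow_Suc_E) blast
qed auto

lemma Range_relpow_Suc:
  fixes S :: "('a \<times> 'a) set"
  shows "Range (S ^^ Suc n) \<subseteq> Range (S ^^ n)"
  by (blast dest: relpow_Suc_D2)

lemma relpow_op_graph:
  fixes f :: "'a \<Rightarrow> 'a"
  shows "op_graph f ^^ n = op_graph (f ^^ n)"
  by (induction n) (auto simp: op_graph_def)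

text \<open>The infimum is finite iff some index works, and a chain of kernels that stops once stops
  forever. The form with all \<open>m \<ge> n\<close> lets finitely many operators share one index,
  which the Bezout transfer needs.\<close>

lemma ascent_less_infinity_iff:
  assumes "(0, 0) \<in> S"
  shows "ascent S < \<infinity> \<longleftrightarrow> (\<exists>n. \<forall>m\<ge>n. \<forall>x. (x, 0) \<in> S ^^ Suc m \<longrightarrow> (x, 0) \<in> S ^^ m)"
    (is "_ \<longleftrightarrow> ?R")
proof -
  have "ascent S < \<infinity> \<longleftrightarrow> (\<exists>n. null_space (S ^^ n) = null_space (S ^^ (n + 1)))"
    unfolding ascent_def Inf_less_iff by (auto simp: less_le)
  also have "\<dots> \<longleftrightarrow> ?R"
  proof
    assume "\<exists>n. null_space (S ^^ n) = null_space (S ^^ (n + 1))"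
    then obtain n where n: "\<And>x. (x, 0) \<in> S ^^ Suc n \<Longrightarrow> (x, 0) \<in> S ^^ n"
      by (auto simp: null_space_def)
    have "(x, 0) \<in> S ^^ Suc m \<Longrightarrow> (x, 0) \<in> S ^^ m" if "m \<ge> n" for m x
      using that
    proof (induction m arbitrary: x rule: dec_induct)
      case base
      then show ?case using n by blast
    next
      case (step m)
      then show ?case by (meson relpow_Suc_D2 relpow_Suc_I2)
    qed
    then show ?R by blast
  next
    assume ?R
    then obtain n where n: "\<And>x. (x, 0) \<in> S ^^ Suc n \<Longrightarrow> (x, 0) \<in> S ^^ n" by blast
    have "(x, 0) \<in> S ^^ n \<Longrightarrow> (x, 0) \<in> S ^^ Suc n" for x
      using assms by (rule relpow_Suc_I[rotated])
    with n have "null_space (S ^^ n) = null_space (S ^^ (n + 1))"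
      unfolding null_space_def by (metis (no_types, lifting) Collect_cong Suc_eq_plus1)
    then show "\<exists>n. null_space (S ^^ n) = null_space (S ^^ (n + 1))" by blast
  qed
  finally show ?thesis .
qed

lemma descent_less_infinity_iff:
  "descent S < \<infinity> \<longleftrightarrow> (\<exists>n. \<forall>m\<ge>n. Range (S ^^ m) \<subseteq> Range (S ^^ Suc m))" (is "_ \<longleftrightarrow> ?R")
proof -
  have "descent S < \<infinity> \<longleftrightarrow> (\<exists>n. Range (S ^^ n) = Range (S ^^ (n + 1)))"
    unfolding descent_def Inf_less_iff by (auto simp: less_le)
  also have "\<dots> \<longleftrightarrow> ?R"
  proof
    assume "\<exists>n. Range (S ^^ n) = Range (S ^^ (n + 1))"
    then obtain n where n: "Range (S ^^ n) \<subseteq> Range (S ^^ Suc n)" by (metis Suc_eq_plus1 order_refl)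
    have "Range (S ^^ m) \<subseteq> Range (S ^^ Suc m)" if "m \<ge> n" for m
      using that
    proof (induction m rule: dec_induct)
      case (step m)
      show ?case
      proof
        fix y assume "y \<in> Range (S ^^ Suc m)"
        then obtain z where "z \<in> Range (S ^^ m)" "(z, y) \<in> S" by auto
        with step.IH obtain x where "(x, z) \<in> S ^^ Suc m" by blast
        with \<open>(z, y) \<in> S\<close> show "y \<in> Range (S ^^ Suc (Suc m))"
          by (meson Range_iff relpow_Suc_I)
      qed
    qed (rule n)
    then show ?R by blast
  next
    assume ?R
    then show "\<exists>n. Range (S ^^ n) = Range (S ^^ (n + 1))"
      using Range_relpow_Suc by (metis Suc_eq_plus1 order_refl subset_antisym)
  qed
  finally show ?thesis .
qed

section \<open>Transfer of semi-Fredholm properties along a factorization\<close>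

text \<open>The model is \<open>S = A - l\<close> and \<open>U = T t - \<mu>\<close>, with
  \<open>S B = U\<close>, \<open>S C + c B = 1\<close>, and \<open>B\<close>, \<open>C\<close>
  commuting with \<open>S\<close>. Stating these as membership in the graph of \<open>S\<close>
  includes the claim that \<open>B\<close> and \<open>C\<close> map into the domain.\<close>

locale operator_factorization =
  fixes S :: "'a::complex_banach operator" and U B C :: "'a \<Rightarrow> 'a" and c :: complex
  assumes single_valued_S: "single_valued S"
    and S_add: "(x, y) \<in> S \<Longrightarrow> (x', y') \<in> S \<Longrightarrow> (x + x', y + y') \<in> S"
    and S_scaleC: "(x, y) \<in> S \<Longrightarrow> (a *\<^sub>C x, a *\<^sub>C y) \<in> S"
    and clinear: "bounded_clinear U" "bounded_clinear B" "bounded_clinear C"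
    and SB: "(B x, U x) \<in> S"
    and SC: "(C x, x - c *\<^sub>C B x) \<in> S"
    and B_S: "(x, y) \<in> S \<Longrightarrow> (B x, B y) \<in> S"
    and C_S: "(x, y) \<in> S \<Longrightarrow> (C x, C y) \<in> S"
begin

lemma S_0: "(0, 0) \<in> S"
  using SB[of 0] by (simp add: bounded_clinear_0[OF clinear(1)] bounded_clinear_0[OF clinear(2)])

lemma S_unique: "(x, y) \<in> S \<Longrightarrow> (x, z) \<in> S \<Longrightarrow> y = z"
  using single_valued_S by (rule single_valuedD)

lemma BS: "(x, y) \<in> S \<Longrightarrow> B y = U x"
  using B_S SB S_unique by blast

lemma CS: "(x, y) \<in> S \<Longrightarrow> C y = x - c *\<^sub>C B x"
  using C_S SC S_unique by blast

lemma UB: "U (B x) = B (U x)"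
  using BS[OF SB] by simp

text \<open>Coprimeness multiplied by \<open>B\<close>: a relation between bounded operators only,
  \<open>B = U C + c B B\<close>, which later allows powers of \<open>B\<close> to be removed modulo
  ranges of \<open>U\<close>.\<close>

lemma UC: "U (C x) = B x - c *\<^sub>C B (B x)"
  using BS[OF SC] by (simp add: bounded_clinear_diff[OF clinear(2)] bounded_clinear_scaleC[OF clinear(2)])

lemma funpow_UB: "(U ^^ n) (B x) = B ((U ^^ n) x)"
  by (induction n) (simp_all add: UB)

lemma funpow_S: "((B ^^ n) x, (U ^^ n) x) \<in> S ^^ n"
proof (induction n arbitrary: x)
  case (Suc n)
  have "((B ^^ n) (B x), B ((U ^^ n) x)) \<in> S ^^ n"
    using Suc[of "B x"] by (simp add: funpow_UB)
  then show ?case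
    using SB[of "(U ^^ n) x"] by (auto intro: relpow_Suc_I simp: funpow_swap1)
qed auto

lemma funpow_BS: "(x, y) \<in> S ^^ n \<Longrightarrow> (B ^^ n) y = (U ^^ n) x"
proof (induction n arbitrary: y)
  case (Suc n)
  then obtain z where z: "(x, z) \<in> S ^^ n" "(z, y) \<in> S" by auto
  then have "(B ^^ Suc n) y = (B ^^ n) (U z)"
    by (simp add: funpow_swap1 BS)
  also have "\<dots> = U ((B ^^ n) z)"
    by (induction n) (simp_all add: UB)
  finally show ?case using Suc.IH[OF z(1)] by simp
qed auto

lemma subspace_Range_relpow: "complex_vector.subspace (Range (S ^^ n))"
proof (rule complex_vector.subspaceI)
  show "0 \<in> Range (S ^^ n)"
    using S_0 by (induction n) (auto intro: relpow_Suc_I)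
  show "x + y \<in> Range (S ^^ n)" if "x \<in> Range (S ^^ n)" "y \<in> Range (S ^^ n)" for x y
    using that relpow_map2[of S "(+)", OF S_add] by blast
  show "a *\<^sub>C x \<in> Range (S ^^ n)" if "x \<in> Range (S ^^ n)" for a x
    using that relpow_map[of S "scaleC a", OF S_scaleC] by blast
qed

lemma subspace_null_space: "complex_vector.subspace (null_space S)"
proof (rule complex_vector.subspaceI)
  show "x + y \<in> null_space S" if "x \<in> null_space S" "y \<in> null_space S" for x y
    using that S_add[of x 0 y 0] by (simp add: null_space_def)
  show "a *\<^sub>C x \<in> null_space S" if "x \<in> null_space S" for a x
    using that S_scaleC[of x 0 a] by (simp add: null_space_def)
qed (simp add: null_space_def S_0)

lemma finite_dimensional_null_space:
  assumes "finite_dimensional (null_space (op_graph U))"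
  shows "finite_dimensional (null_space S)"
proof -
  have "null_space S \<subseteq> null_space (op_graph U)"
    using BS by (fastforce simp: null_space_def op_graph_def bounded_clinear_0[OF clinear(2)])
  then show ?thesis
    using assms subspace_null_space finite_dimensional_subspace
    unfolding finite_dimensional_def by metis
qed

text \<open>If \<open>S (x n)\<close> tends to \<open>l\<close>, then
  \<open>B (S (x n)) = U (x n)\<close> tends to \<open>B l\<close>, so \<open>B l = U z\<close> for
  some \<open>z\<close>. Coprimeness recovers \<open>l\<close> itself:
  \<open>l = S (C l) + c B l = S (C l + c B z)\<close>.\<close>

lemma closed_Range:
  assumes "closed (Range (op_graph U))"
  shows "closed (Range S)"
  unfolding closed_sequential_limits
proof (intro allI impI, elim conjE)
  fix y l assume "\<forall>n. y n \<in> Range S" and lim: "y \<longlonglongrightarrow> l"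
  then obtain x where "\<And>n. (x n, y n) \<in> S" unfolding Range_iff by metis
  then have "B (y n) \<in> Range (op_graph U)" for n
    using BS by (force simp: op_graph_def)
  moreover have "(\<lambda>n. B (y n)) \<longlonglongrightarrow> B l"
    using bounded_clinear_imp_bounded_linear[OF clinear(2)] lim by (rule bounded_linear.tendsto)
  ultimately have "B l \<in> Range (op_graph U)"
    by (rule closed_sequentially[OF assms])
  then obtain z where "B l = U z" by (auto simp: op_graph_def)
  then have "(C l + c *\<^sub>C B z, l - c *\<^sub>C B l + c *\<^sub>C B l) \<in> S"
    using S_add[OF SC S_scaleC[OF SB]] by metis
  then show "l \<in> Range S" by auto
qed

lemma finite_codimensional_Range:
  assumes "finite_codimensional (Range (op_graph U))"
  shows "finite_codimensional (Range S)"
proof -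
  have "Range (op_graph U) \<subseteq> Range S"
    using SB by (auto simp: op_graph_def)
  then show ?thesis
    using assms unfolding finite_codimensional_def by (meson subsetD)
qed

text \<open>Put \<open>y = S^m x\<close> with \<open>S y = 0\<close>. Finite ascent of
  \<open>U\<close> gives \<open>B^m y = U^m x = 0\<close>, while on the kernel of \<open>S\<close>
  the map \<open>c B\<close> is the identity, so \<open>y = c^m B^m y = 0\<close>.\<close>

lemma ascent_finite:
  assumes "ascent (op_graph U) < \<infinity>"
  shows "ascent S < \<infinity>"
proof -
  have "(0, 0) \<in> op_graph U"
    by (simp add: op_graph_def bounded_clinear_0[OF clinear(1)])
  then obtain n where n: "\<And>m x. m \<ge> n \<Longrightarrow> (U ^^ Suc m) x = 0 \<Longrightarrow> (U ^^ m) x = 0"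
    using assms unfolding ascent_less_infinity_iff[OF \<open>(0, 0) \<in> op_graph U\<close>] relpow_op_graph
    by (auto simp: op_graph_def)
  have "(x, 0) \<in> S ^^ m" if "m \<ge> n" and "(x, 0) \<in> S ^^ Suc m" for m x
  proof -
    obtain y where y: "(x, y) \<in> S ^^ m" "(y, 0) \<in> S" using \<open>(x, 0) \<in> S ^^ Suc m\<close> by auto
    have B0: "(B ^^ k) 0 = 0" for k
      by (induction k) (simp_all add: bounded_clinear_0[OF clinear(2)])
    have "(U ^^ m) x = 0"
      using n[OF \<open>m \<ge> n\<close>] funpow_BS[OF \<open>(x, 0) \<in> S ^^ Suc m\<close>] B0 by metis
    then have B_y: "(B ^^ m) y = 0"
      using funpow_BS[OF y(1)] by simp
    have y_fix: "y = c *\<^sub>C B y"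
      using CS[OF y(2)] by (simp add: bounded_clinear_0[OF clinear(3)])
    have "y = c ^ k *\<^sub>C (B ^^ k) y" for k
    proof (induction k)
      case (Suc k)
      have "y = c *\<^sub>C B (c ^ k *\<^sub>C (B ^^ k) y)"
        using y_fix Suc by simp
      then show ?case
        by (simp add: bounded_clinear_scaleC[OF clinear(2)] scaleC_scaleC)
    qed (simp add: scaleC_one)
    then have "y = 0" using B_y by (metis scaleC.zero_right)
    then show ?thesis using y by simp
  qed
  then show ?thesis
    unfolding ascent_less_infinity_iff[OF S_0] by blast
qed

text \<open>For \<open>y = S^m x\<close> the vector \<open>B^m y = U^m x\<close> lies in the range
  of \<open>U^(m+1)\<close>, hence in that of \<open>S^(m+1)\<close>. The powers of \<open>B\<close>
  are then stripped off one at a time.\<close>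

lemma descent_finite:
  assumes "descent (op_graph U) < \<infinity>"
  shows "descent S < \<infinity>"
proof -
  obtain n where n: "\<And>m. m \<ge> n \<Longrightarrow> range (U ^^ m) \<subseteq> range (U ^^ Suc m)"
    using assms unfolding descent_less_infinity_iff relpow_op_graph
    by (fastforce simp: op_graph_def)
  have "y \<in> Range (S ^^ Suc m)" if "m \<ge> n" and y: "y \<in> Range (S ^^ m)" for m y
  proof -
    \<comment> \<open>Uses \<open>z = S (C z) + c B z\<close>: since \<open>C\<close> preserves the
      range of \<open>S^m\<close>, the first summand is already in the range of
      \<open>S^(m+1)\<close>.\<close>
    have reduce: "z \<in> Range (S ^^ Suc m)"
      if "z \<in> Range (S ^^ m)" "B z \<in> Range (S ^^ Suc m)" for z
    proof -
      have "C z \<in> Range (S ^^ m)"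
        using \<open>z \<in> Range (S ^^ m)\<close> relpow_map[of S C, OF C_S] by blast
      then have "z - c *\<^sub>C B z \<in> Range (S ^^ Suc m)"
        using SC[of z] by (meson Range_iff relpow_Suc_I)
      then have "z - c *\<^sub>C B z + c *\<^sub>C B z \<in> Range (S ^^ Suc m)"
        using \<open>B z \<in> _\<close> subspace_Range_relpow
        by (meson complex_vector.subspace_add complex_vector.subspace_scale)
      then show ?thesis by simp
    qed
    obtain x where x: "(x, y) \<in> S ^^ m" using y by blast
    obtain z where "(U ^^ m) x = (U ^^ Suc m) z"
      using n[OF \<open>m \<ge> n\<close>] by blast
    then have "(B ^^ m) y = (U ^^ Suc m) z"
      using funpow_BS[OF x] by simp
    then have B_y: "(B ^^ m) y \<in> Range (S ^^ Suc m)"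
      using funpow_S[of "Suc m" z] by (metis RangeI)
    have "(B ^^ k) y \<in> Range (S ^^ Suc m) \<Longrightarrow> y \<in> Range (S ^^ Suc m)" for k
    proof (induction k)
      case (Suc k)
      have "(B ^^ j) y \<in> Range (S ^^ m)" for j
        using y relpow_map[of S B, OF B_S] by (induction j) auto
      with Suc reduce show ?case by simp
    qed simp
    with B_y show ?thesis by blast
  qed
  then show ?thesis
    unfolding descent_less_infinity_iff by blast
qed

end

section \<open>Converse transfer along a Bezout identity\<close>

text \<open>One bounded \<open>U\<close> factors through every \<open>S k\<close>, and
  \<open>bezout\<close> splits each vector into pieces \<open>B k (Q k x)\<close> plus a multiple of
  \<open>U\<close>. Each piece is governed by a single \<open>S k\<close>, so a property of
  \<open>U\<close> is checked piece by piece; the commutation laws keep the pieces inside kernels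
  and ranges.\<close>

locale bezout_factorization =
  fixes F :: "'i set" and S :: "'i \<Rightarrow> 'a::complex_banach operator" and U :: "'a \<Rightarrow> 'a"
    and B C Q :: "'i \<Rightarrow> 'a \<Rightarrow> 'a" and c :: "'i \<Rightarrow> complex" and V :: "'a \<Rightarrow> 'a"
  assumes finite_F: "finite F"
    and factor: "k \<in> F \<Longrightarrow> operator_factorization (S k) U (B k) (C k) (c k)"
    and clinear_U: "bounded_clinear U"
    and clinear_Q: "k \<in> F \<Longrightarrow> bounded_clinear (Q k)"
    and clinear_V: "bounded_clinear V"
    and bezout: "(\<Sum>k\<in>F. B k (Q k x)) + U (V x) = x"
    and QB: "k \<in> F \<Longrightarrow> Q k (B k x) = B k (Q k x)"
    and QU: "k \<in> F \<Longrightarrow> Q k (U x) = U (Q k x)"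
    and VU: "V (U x) = U (V x)"
begin

lemma subspace_range_U: "complex_vector.subspace (range (U ^^ n))"
proof -
  have "bounded_clinear (U ^^ n)"
    by (rule bounded_clinear_funpow[OF clinear_U])
  note lin = bounded_clinear_simps[OF this]
  show ?thesis
  proof (rule complex_vector.subspaceI)
    show "0 \<in> range (U ^^ n)" by (metis lin(3) rangeI)
    show "x + y \<in> range (U ^^ n)" if "x \<in> range (U ^^ n)" "y \<in> range (U ^^ n)" for x y
      using that by (auto simp: lin(1)[symmetric])
    show "a *\<^sub>C x \<in> range (U ^^ n)" if "x \<in> range (U ^^ n)" for a x
      using that by (auto simp: lin(5)[symmetric])
  qed
qed

text \<open>On the kernel of \<open>U\<close> the term \<open>U V\<close> vanishes, and
  \<open>S k (B k (Q k x)) = U (Q k x) = 0\<close>; so this kernel is contained in the sum of the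
  kernels of the \<open>S k\<close>.\<close>

lemma finite_dimensional_null_space:
  assumes "\<And>k. k \<in> F \<Longrightarrow> finite_dimensional (null_space (S k))"
  shows "finite_dimensional (null_space (op_graph U))"
proof -
  obtain W where W: "\<And>k. k \<in> F \<Longrightarrow> finite (W k) \<and> null_space (S k) = complex_vector.span (W k)"
    using assms unfolding finite_dimensional_def by metis
  have "x \<in> complex_vector.span (\<Union>k\<in>F. W k)" if "U x = 0" for x
  proof -
    have "B k (Q k x) \<in> complex_vector.span (\<Union>k\<in>F. W k)" if "k \<in> F" for k
    proof -
      have "U (Q k x) = 0"
        using \<open>U x = 0\<close> QU[OF that] bounded_clinear_0[OF clinear_Q[OF that]] by metis
      then have "B k (Q k x) \<in> null_space (S k)"
        using operator_factorization.SB[OF factor[OF that], of "Q k x"] by (simp add: null_space_def)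
      then show ?thesis
        using W[OF that] complex_vector.span_mono[of "W k" "\<Union>k\<in>F. W k"] that by blast
    qed
    moreover have "U (V x) = 0"
      using \<open>U x = 0\<close> VU bounded_clinear_0[OF clinear_V] by metis
    then have "(\<Sum>k\<in>F. B k (Q k x)) = x"
      using bezout[of x] by simp
    ultimately show ?thesis
      using complex_vector.span_sum[of F "\<lambda>k. B k (Q k x)"] by simp
  qed
  then have "null_space (op_graph U) \<subseteq> complex_vector.span (\<Union>k\<in>F. W k)"
    by (auto simp: null_space_def op_graph_def)
  moreover have "finite (\<Union>k\<in>F. W k)"
    using W finite_F by blast
  moreover have "complex_vector.subspace (null_space (op_graph U))"
    using bounded_clinear_simps[OF clinear_U]
    by (auto simp: complex_vector.subspace_def null_space_def op_graph_def)
  ultimately show ?thesis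
    using finite_dimensional_subspace by blast
qed

lemma mem_range_U:
  assumes "\<And>k. k \<in> F \<Longrightarrow> B k (Q k y) \<in> range U"
  shows "y \<in> range U"
proof -
  have "complex_vector.subspace (range U)"
    using subspace_range_U[of 1] by simp
  then have "(\<Sum>k\<in>F. B k (Q k y)) + U (V y) \<in> range U"
    using assms by (intro complex_vector.subspace_add complex_vector.subspace_sum) auto
  then show ?thesis by (simp add: bezout)
qed

lemma closed_Range:
  assumes "\<And>k. k \<in> F \<Longrightarrow> closed (Range (S k))"
  shows "closed (Range (op_graph U))"
  unfolding closed_sequential_limits
proof (intro allI impI, elim conjE)
  fix y l assume "\<forall>n. y n \<in> Range (op_graph U)" and lim: "y \<longlonglongrightarrow> l"
  then obtain x where x: "\<And>n. y n = U (x n)"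
    by (auto simp: op_graph_def Range_iff) metis
  have "B k (Q k l) \<in> range U" if "k \<in> F" for k
  proof -
    interpret operator_factorization "S k" U "B k" "C k" "c k" by (rule factor[OF that])
    have "y n \<in> Range (S k)" for n
      using SB[of "x n"] x by auto
    then have "l \<in> Range (S k)"
      using closed_sequentially[OF assms[OF that] _ lim] by blast
    then obtain z where z: "(z, l) \<in> S k" by blast
    \<comment> \<open>Here \<open>B k l = B k (S k z) = U z\<close>, and \<open>Q k\<close> commutes
      with both \<open>B k\<close> and \<open>U\<close>.\<close>
    have "B k (Q k l) = U (Q k z)"
      using BS[OF z] QB[OF that] QU[OF that] by metis
    then show ?thesis by simp
  qed
  then show "l \<in> Range (op_graph U)"
    using mem_range_U[of l] by (auto simp: op_graph_def)
qed

text \<open>Writing \<open>Q k x = S k z + w\<close> with \<open>w\<close> in a finite-dimensional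
  complement gives \<open>B k (Q k x) = U z + B k w\<close>, so the images \<open>B k w\<close> span
  the space modulo the range of \<open>U\<close>.\<close>

lemma finite_codimensional_Range:
  assumes "\<And>k. k \<in> F \<Longrightarrow> finite_codimensional (Range (S k))"
  shows "finite_codimensional (Range (op_graph U))"
proof -
  have "\<forall>k\<in>F. \<exists>W. finite W \<and> (\<forall>x. \<exists>r\<in>Range (S k). x - r \<in> complex_vector.span W)"
    using assms by (simp add: finite_codimensional_def)
  from bchoice[OF this] obtain W where
    "\<forall>k\<in>F. finite (W k) \<and> (\<forall>x. \<exists>r\<in>Range (S k). x - r \<in> complex_vector.span (W k))"
    by (elim exE)
  then have W: "\<And>k. k \<in> F \<Longrightarrow> finite (W k)"
      "\<And>k x. k \<in> F \<Longrightarrow> \<exists>r\<in>Range (S k). x - r \<in> complex_vector.span (W k)"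
    by simp_all
  let ?W = "\<Union>k\<in>F. B k ` W k"
  have "\<exists>r\<in>range U. x - r \<in> complex_vector.span ?W" for x
  proof -
    have "\<exists>u. B k (Q k x) - U u \<in> complex_vector.span ?W" if k: "k \<in> F" for k
    proof -
      interpret operator_factorization "S k" U "B k" "C k" "c k" by (rule factor[OF that])
      obtain z r where r: "(z, r) \<in> S k" "Q k x - r \<in> complex_vector.span (W k)"
        using W(2)[OF k, of "Q k x"] by blast
      have "B k (Q k x - r) \<in> complex_vector.span (B k ` W k)"
        using bounded_clinear_span[OF clinear(2) r(2)] .
      then have "B k (Q k x) - U z \<in> complex_vector.span (B k ` W k)"
        using BS[OF r(1)] by (simp add: bounded_clinear_diff[OF clinear(2)])
      then show ?thesis
        using complex_vector.span_mono[of "B k ` W k" ?W] that by blast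
    qed
    then obtain u where "\<And>k. k \<in> F \<Longrightarrow> B k (Q k x) - U (u k) \<in> complex_vector.span ?W"
      by metis
    then have "(\<Sum>k\<in>F. B k (Q k x) - U (u k)) \<in> complex_vector.span ?W"
      by (rule complex_vector.span_sum)
    also have "(\<Sum>k\<in>F. B k (Q k x) - U (u k)) = x - U ((\<Sum>k\<in>F. u k) + V x)"
      using bezout[of x, symmetric]
      by (simp add: sum_subtractf bounded_clinear_add[OF clinear_U] bounded_clinear_sum[OF clinear_U]
          algebra_simps)
    finally show ?thesis by blast
  qed
  moreover have "Range (op_graph U) = range U" by (auto simp: op_graph_def)
  moreover have "finite ?W" using W(1) finite_F by blast
  ultimately show ?thesis unfolding finite_codimensional_def by metis
qed

lemma ascent_finite:
  assumes "\<And>k. k \<in> F \<Longrightarrow> ascent (S k) < \<infinity>"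
  shows "ascent (op_graph U) < \<infinity>"
proof -
  have "\<forall>k\<in>F. \<exists>n. \<forall>m\<ge>n. \<forall>x. (x, 0) \<in> S k ^^ Suc m \<longrightarrow> (x, 0) \<in> S k ^^ m"
  proof
    fix k assume "k \<in> F"
    then show "\<exists>n. \<forall>m\<ge>n. \<forall>x. (x, 0) \<in> S k ^^ Suc m \<longrightarrow> (x, 0) \<in> S k ^^ m"
      using assms ascent_less_infinity_iff[OF operator_factorization.S_0[OF factor]] by metis
  qed
  from bchoice[OF this] obtain n where
    n: "\<And>k m x. k \<in> F \<Longrightarrow> m \<ge> n k \<Longrightarrow> (x, 0) \<in> S k ^^ Suc m \<Longrightarrow> (x, 0) \<in> S k ^^ m"
    by blast
  have U0: "(0, 0) \<in> op_graph U"
    by (simp add: op_graph_def bounded_clinear_0[OF clinear_U])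
  \<comment> \<open>For empty \<open>F\<close> the value of \<open>Max\<close> is arbitrary but
    harmless: then \<open>bezout\<close> reduces to \<open>U V = 1\<close>, and no
    \<open>n k\<close> has to be exceeded.\<close>
  have "(U ^^ m) x = 0" if "m \<ge> Max (n ` F)" and "(U ^^ Suc m) x = 0" for m x
  proof -
    have "B k (Q k ((U ^^ m) x)) = 0" if "k \<in> F" for k
    proof -
      interpret operator_factorization "S k" U "B k" "C k" "c k" by (rule factor[OF that])
      have "m \<ge> n k"
        using \<open>m \<ge> Max (n ` F)\<close> that finite_F by (meson Max_ge finite_imageI imageI order_trans)
      \<comment> \<open>The spare factor \<open>B k\<close> pays for the extra power of
        \<open>S k\<close>: once that power is dropped, \<open>S k ^^ m\<close> applied to
        \<open>B k ^^ m (B k x)\<close> leaves \<open>U^m (B k x) = 0\<close>.\<close>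
      moreover have "((B k ^^ m) (B k x), 0) \<in> S k ^^ Suc m"
        using funpow_S[of "Suc m" x] \<open>(U ^^ Suc m) x = 0\<close> by (simp add: funpow_swap1)
      ultimately have "((B k ^^ m) (B k x), 0) \<in> S k ^^ m"
        using n that by blast
      then have "(U ^^ m) (B k x) = 0"
        using funpow_S[of m "B k x"] single_valued_relpow[OF single_valued_S]
        by (metis single_valuedD)
      then show ?thesis
        using funpow_UB QB[OF that] bounded_clinear_0[OF clinear_Q[OF that]] by metis
    qed
    moreover have "U (V ((U ^^ m) x)) = 0"
      using \<open>(U ^^ Suc m) x = 0\<close> VU bounded_clinear_0[OF clinear_V]
      by (metis funpow.simps(2) o_apply)
    ultimately show ?thesis
      using bezout[of "(U ^^ m) x"] by simp
  qed
  then show ?thesis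
    unfolding ascent_less_infinity_iff[OF U0] relpow_op_graph by (auto simp: op_graph_def)
qed

lemma descent_finite:
  assumes "\<And>k. k \<in> F \<Longrightarrow> descent (S k) < \<infinity>"
  shows "descent (op_graph U) < \<infinity>"
proof -
  have "\<forall>k\<in>F. \<exists>n. \<forall>m\<ge>n. Range (S k ^^ m) \<subseteq> Range (S k ^^ Suc m)"
    using assms by (simp only: descent_less_infinity_iff) simp
  from bchoice[OF this] obtain n where
    n: "\<And>k m. k \<in> F \<Longrightarrow> m \<ge> n k \<Longrightarrow> Range (S k ^^ m) \<subseteq> Range (S k ^^ Suc m)"
    by blast
  have "y \<in> range (U ^^ Suc m)" if "m \<ge> Max (n ` F)" and "y \<in> range (U ^^ m)" for m y
  proof -
    note sub = complex_vector.subspace_add[OF subspace_range_U]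
      complex_vector.subspace_scale[OF subspace_range_U]
    have "B k (Q k y) \<in> range (U ^^ Suc m)" if k: "k \<in> F" for k
    proof -
      interpret operator_factorization "S k" U "B k" "C k" "c k" by (rule factor[OF that])
      have "m \<ge> n k"
        using \<open>m \<ge> Max (n ` F)\<close> that finite_F by (meson Max_ge finite_imageI imageI order_trans)
      obtain x where x: "y = (U ^^ m) x" using \<open>y \<in> range (U ^^ m)\<close> by blast
      have UQ: "(U ^^ j) (Q k z) = Q k ((U ^^ j) z)" for j z
        by (induction j) (simp_all add: QU[OF that])
      let ?w = "Q k x"
      have comm: "(U ^^ m) ((B k ^^ j) z) = (B k ^^ j) ((U ^^ m) z)" for j z
        by (induction j) (simp_all add: funpow_UB)
      \<comment> \<open>Apply \<open>U^m\<close> to \<open>B z = U (C z) + c B (B z)\<close>: one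
        factor \<open>B k\<close> can be removed as long as another one remains.\<close>
      have raise: "B k ((U ^^ m) z) \<in> range (U ^^ Suc m)"
        if "B k (B k ((U ^^ m) z)) \<in> range (U ^^ Suc m)" for z
      proof -
        have "U ((U ^^ m) (C k z)) = (U ^^ m) (U (C k z))"
          by (simp add: funpow_swap1)
        also have "\<dots> = B k ((U ^^ m) z) - c k *\<^sub>C B k (B k ((U ^^ m) z))"
        proof -
          have "bounded_clinear (U ^^ m)"
            by (rule bounded_clinear_funpow[OF clinear(1)])
          then show ?thesis
            by (simp add: UC bounded_clinear_diff bounded_clinear_scaleC funpow_UB)
        qed
        finally have "B k ((U ^^ m) z) =
            (U ^^ Suc m) (C k z) + c k *\<^sub>C B k (B k ((U ^^ m) z))"
          by simp
        then show ?thesis using sub that by (metis rangeI)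
      qed
      \<comment> \<open>\<open>U^m w\<close> is in the range of \<open>S k ^^ m\<close>, hence by
        finite descent in that of \<open>S k ^^ Suc m\<close>. Applying \<open>B k ^^ Suc m\<close>
        then yields \<open>U^(m+1) v\<close>.\<close>
      obtain v where v: "(v, (U ^^ m) ?w) \<in> S k ^^ Suc m"
        using n[OF k \<open>m \<ge> n k\<close>] funpow_S[of m ?w] by blast
      have top: "(B k ^^ Suc m) ((U ^^ m) ?w) \<in> range (U ^^ Suc m)"
        using funpow_BS[OF v] by (metis rangeI)
      have "(B k ^^ Suc j) ((U ^^ m) ?w) \<in> range (U ^^ Suc m) \<Longrightarrow>
          B k ((U ^^ m) ?w) \<in> range (U ^^ Suc m)" for j
      proof (induction j)
        case (Suc j)
        have "B k ((U ^^ m) ((B k ^^ j) ?w)) \<in> range (U ^^ Suc m)"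
          using Suc.prems by (intro raise) (simp add: comm)
        then show ?case using Suc.IH by (simp add: comm)
      qed simp
      with top have "B k ((U ^^ m) ?w) \<in> range (U ^^ Suc m)" by blast
      then show ?thesis by (simp add: x UQ)
    qed
    moreover have "U (V y) \<in> range (U ^^ Suc m)"
    proof -
      obtain x where "y = (U ^^ m) x" using \<open>y \<in> range (U ^^ m)\<close> by blast
      moreover have "V ((U ^^ j) x) = (U ^^ j) (V x)" for j
        by (induction j) (simp_all add: VU)
      ultimately show ?thesis by (metis funpow.simps(2) o_apply rangeI)
    qed
    ultimately have "(\<Sum>k\<in>F. B k (Q k y)) + U (V y) \<in> range (U ^^ Suc m)"
      by (intro complex_vector.subspace_add complex_vector.subspace_sum subspace_range_U)
    then show ?thesis by (simp only: bezout)
  qed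
  moreover have "Range (op_graph f) = range f" for f :: "'a \<Rightarrow> 'a"
    by (auto simp: op_graph_def)
  ultimately show ?thesis
    unfolding descent_less_infinity_iff relpow_op_graph by (simp only:) blast
qed

end

section \<open>Uniform boundedness\<close>

text \<open>Baire category: one of the closed sets \<open>G n\<close> contains a ball, and
  differences of points of that ball bound the family near 0.\<close>

lemma uniform_boundedness:
  fixes f :: "'i \<Rightarrow> 'a::banach \<Rightarrow> 'b::real_normed_vector"
  assumes lin: "\<And>i. i \<in> I \<Longrightarrow> bounded_linear (f i)"
    and bdd: "\<And>x. \<exists>M. \<forall>i\<in>I. norm (f i x) \<le> M"
  shows "\<exists>M>0. \<forall>i\<in>I. \<forall>x. norm (f i x) \<le> M * norm x"
proof -
  define G where "G n = {x. \<forall>i\<in>I. norm (f i x) \<le> real n}" for n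
  have closed_G: "closed (G n)" for n
  proof -
    have "G n = (\<Inter>i\<in>I. {x. norm (f i x) \<le> real n})"
      by (auto simp: G_def)
    moreover have "closed {x. norm (f i x) \<le> real n}" if "i \<in> I" for i
      using linear_continuous_on[OF lin[OF that], of UNIV]
      by (intro closed_Collect_le) (auto intro!: continuous_intros)
    ultimately show ?thesis by (simp add: closed_INT)
  qed
  have "x \<in> \<Union>(range G)" for x
  proof -
    obtain M where "\<forall>i\<in>I. norm (f i x) \<le> M" using bdd by blast
    moreover obtain n where "M \<le> real n" using real_arch_simple by blast
    ultimately have "x \<in> G n" unfolding G_def by fastforce
    then show ?thesis by blast
  qed
  then have "\<Union>(range G) = UNIV" by blast
  then have "(euclidean :: 'a topology) interior_of \<Union>(range G) \<noteq> {}"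
    by simp
  then obtain n where "interior (G n) \<noteq> {}"
    using Baire_category_alt[of "euclidean :: 'a topology" "range G"] closed_G
      completely_metrizable_space_euclidean[where 'a='a]
    by (auto simp: closed_closedin[symmetric])
  then obtain x0 e where e: "e > 0" "cball x0 e \<subseteq> G n"
    by (metis all_not_in_conv mem_interior_cball)
  have "norm (f i x) \<le> (2 * real n / e) * norm x" if "i \<in> I" for i x
  proof (cases "x = 0")
    case True
    then show ?thesis using linear_0[OF bounded_linear.linear[OF lin[OF that]]] by simp
  next
    case False
    let ?y = "(e / norm x) *\<^sub>R x"
    have "norm (f i (x0 + ?y)) \<le> real n"
      using e that False by (auto simp: G_def subset_iff dist_norm)
    moreover have "norm (f i x0) \<le> real n"
      using e that by (auto simp: G_def subset_iff)
    moreover have "f i ?y = f i (x0 + ?y) - f i x0"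
      using linear_add[OF bounded_linear.linear[OF lin[OF that]]] by simp
    ultimately have "norm (f i ?y) \<le> 2 * real n"
      using norm_triangle_ineq4[of "f i (x0 + ?y)" "f i x0"] by simp
    also have "f i ?y = (e / norm x) *\<^sub>R f i x"
      using linear_scale[OF bounded_linear.linear[OF lin[OF that]]] by simp
    finally show ?thesis
      using e(1) False by (simp add: field_simps)
  qed
  then have "norm (f i x) \<le> (2 * real n / e + 1) * norm x" if "i \<in> I" for i x
    using that by (smt (verit) mult_right_mono norm_ge_zero)
  moreover have "2 * real n / e + 1 > 0"
    using e(1) by (simp add: add_nonneg_pos)
  ultimately show ?thesis by blast
qed

lemma bounded_clinear_limit:
  assumes f: "\<And>n. bounded_clinear (f n)" and lim: "\<And>x. (\<lambda>n::nat. f n x) \<longlonglongrightarrow> g x"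
  shows "bounded_clinear g"
proof -
  have "\<exists>M. \<forall>n\<in>UNIV. norm (f n x) \<le> M" for x
    using convergent_imp_bounded[OF lim[of x]] by (auto simp: bounded_iff)
  then obtain M where M: "\<And>n x. norm (f n x) \<le> M * norm x"
    using uniform_boundedness[of UNIV f] f bounded_clinear_imp_bounded_linear by blast
  have bound: "norm (g x) \<le> norm x * M" for x
    using lim[of x] M by (intro tendsto_upperbound[OF tendsto_norm]) (auto simp: mult.commute)
  have add: "g (x + y) = g x + g y" for x y
    using tendsto_add[OF lim[of x] lim[of y]] lim[of "x + y"] f
    by (simp add: bounded_clinear_add LIMSEQ_unique)
  have scale: "g (c *\<^sub>C x) = c *\<^sub>C g x" for c x
    using scaleC.tendsto[OF tendsto_const lim[of x], of c] lim[of "c *\<^sub>C x"] f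
    by (simp add: bounded_clinear_scaleC LIMSEQ_unique)
  have "bounded_linear g"
    by (rule bounded_linear_intro[of g M]) (simp_all add: add bound scale scaleR_scaleC)
  then show ?thesis by (simp add: bounded_clinear_def scale)
qed

section \<open>Differentiable semigroups\<close>

lemma has_vector_derivative_imp_right_quotient:
  fixes f :: "real \<Rightarrow> 'a::real_normed_vector"
  assumes "(f has_vector_derivative D) (at a within {a..b})" and "a < b"
  shows "((\<lambda>h. (f (h + a) - f a) /\<^sub>R h) \<longlongrightarrow> D) (at_right 0)"
proof -
  have "((\<lambda>y. (1 / norm (y - a)) *\<^sub>R (f y - (f a + (y - a) *\<^sub>R D))) \<longlongrightarrow> 0) (at_right a)"
    using assms by (simp add: has_vector_derivative_def has_derivative_within at_within_Icc_at_right)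
  then have "((\<lambda>h. (1 / norm h) *\<^sub>R (f (h + a) - (f a + h *\<^sub>R D))) \<longlongrightarrow> 0) (at_right 0)"
    by (subst (asm) filterlim_at_right_to_0) simp
  moreover have "\<forall>\<^sub>F h in at_right 0.
      (1 / norm h) *\<^sub>R (f (h + a) - (f a + h *\<^sub>R D)) = (f (h + a) - f a) /\<^sub>R h - D"
    using eventually_at_right_less[of 0]
    by eventually_elim (simp add: algebra_simps divide_inverse)
  ultimately have "((\<lambda>h. (f (h + a) - f a) /\<^sub>R h - D) \<longlongrightarrow> 0) (at_right 0)"
    by (rule Lim_transform_eventually)
  then show ?thesis by (rule LIM_zero_cancel)
qed

lemma has_vector_derivative_shift:
  assumes "(f has_vector_derivative D) (at (h + s))"
  shows "((\<lambda>r. f (h + r)) has_vector_derivative D) (at s)"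
proof -
  have "((\<lambda>r. h + r) has_vector_derivative 1) (at s)"
    by (auto intro!: derivative_eq_intros)
  from vector_diff_chain_at[OF this assms] show ?thesis by (simp add: o_def)
qed

locale diff_semigroup =
  fixes T :: "real \<Rightarrow> 'a::complex_banach \<Rightarrow> 'a"
  assumes differentiable: "differentiable_semigroup T"
begin

lemma C0: "C0_semigroup T"
  using differentiable by (simp add: differentiable_semigroup_def)

lemma clinear_T: "t \<ge> 0 \<Longrightarrow> bounded_clinear (T t)"
  using C0 by (simp add: C0_semigroup_def)

lemma linear_T: "t \<ge> 0 \<Longrightarrow> bounded_linear (T t)"
  by (rule bounded_clinear_imp_bounded_linear[OF clinear_T])

lemma T_0 [simp]: "T 0 x = x"
  using C0 by (simp add: C0_semigroup_def)

lemma T_add: "s \<ge> 0 \<Longrightarrow> t \<ge> 0 \<Longrightarrow> T (s + t) x = T s (T t x)"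
  using C0 by (simp add: C0_semigroup_def)

lemma T_commute: "s \<ge> 0 \<Longrightarrow> t \<ge> 0 \<Longrightarrow> T s (T t x) = T t (T s x)"
  using T_add by (metis add.commute)

text \<open>Differentiability settles positive times and the C0 property settles time 0. Local
  boundedness can thus be deduced from continuity, through compactness of orbit segments and uniform
  boundedness, instead of preceding it.\<close>

lemma continuous_on_orbit: "continuous_on {0..} (\<lambda>s. T s x)"
proof -
  have "((\<lambda>s. T s x) \<longlongrightarrow> T t x) (at t within {0..})" if "t \<ge> 0" for t
  proof (cases "t = 0")
    case True
    have "((\<lambda>s. T s x) \<longlongrightarrow> x) (at_right 0)"
      using C0 by (simp add: C0_semigroup_def)
    moreover have "at (0::real) within {0..} = at_right 0"
      by (simp add: at_within_def) (metis (no_types, lifting) Diff_insert_absorb atLeast_def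
          greaterThan_def ivl_disj_un_singleton(1) greaterThan_iff less_irrefl insert_is_Un)
    ultimately show ?thesis using True by simp
  next
    case False
    then have "(\<lambda>s. T s x) differentiable (at t)"
      using differentiable that by (simp add: differentiable_semigroup_def)
    then show ?thesis
      using continuous_at_imp_continuous_at_within differentiable_imp_continuous_within
      by (metis continuous_within)
  qed
  then show ?thesis by (auto simp: continuous_on_def)
qed

lemma bounded_T:
  obtains M where "M > 0" "\<And>s x. 0 \<le> s \<Longrightarrow> s \<le> a \<Longrightarrow> norm (T s x) \<le> M * norm x"
proof -
  have "\<exists>M. \<forall>s\<in>{0..a}. norm (T s x) \<le> M" for x
  proof -
    have "compact ((\<lambda>s. T s x) ` {0..a})"
      by (intro compact_continuous_image continuous_on_subset[OF continuous_on_orbit]) auto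
    then show ?thesis
      using compact_imp_bounded bounded_iff by (metis image_eqI)
  qed
  then show ?thesis
    using uniform_boundedness[of "{0..a}" T] linear_T that by auto
qed

section \<open>The bounded operators \<open>A T(h)\<close> at positive times\<close>

text \<open>This is the product of the generator with \<open>T h\<close>, as
  \<open>generator_T\<close> confirms. Defining it as a derivative of the orbit makes it total and
  avoids any mention of the domain.\<close>

definition AT :: "real \<Rightarrow> 'a \<Rightarrow> 'a"
  where "AT h x = vector_derivative (\<lambda>s. T s x) (at h)"

lemma orbit_has_vector_derivative:
  "h > 0 \<Longrightarrow> ((\<lambda>s. T s x) has_vector_derivative AT h x) (at h)"
  using differentiable unfolding AT_def differentiable_semigroup_def
  by (simp add: vector_derivative_works)

lemma shifted_orbit_has_vector_derivative:
  assumes "h > 0" "s \<ge> 0"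
  shows "((\<lambda>s. T (h + s) x) has_vector_derivative AT (h + s) x) (at s)"
  using assms by (intro has_vector_derivative_shift orbit_has_vector_derivative) simp

lemma has_vector_derivative_unique_orbit:
  assumes "h > 0" "(f has_vector_derivative D) (at h)" "\<And>s. s > 0 \<Longrightarrow> f s = T s x"
  shows "D = AT h x"
proof (rule vector_derivative_unique_at)
  show "((\<lambda>s. T s x) has_vector_derivative D) (at h)"
    by (rule has_vector_derivative_transform_within_open[OF assms(2), of "{0<..}"])
      (use assms in auto)
qed (rule orbit_has_vector_derivative[OF assms(1)])

lemma AT_T:
  assumes "h > 0" "s \<ge> 0"
  shows "AT h (T s x) = AT (h + s) x"
proof (rule has_vector_derivative_unique_orbit[OF assms(1), symmetric])
  show "((\<lambda>r. T (s + r) x) has_vector_derivative AT (h + s) x) (at h)"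
    using assms
    by (subst add.commute, intro has_vector_derivative_shift orbit_has_vector_derivative) simp
  show "T (s + r) x = T r (T s x)" if "r > 0" for r
    using T_add[of r s x] assms that by (simp add: add.commute)
qed

lemma T_AT:
  assumes "h > 0" "s \<ge> 0"
  shows "T s (AT h x) = AT h (T s x)"
proof (rule has_vector_derivative_unique_orbit[OF assms(1)])
  show "((\<lambda>r. T s (T r x)) has_vector_derivative T s (AT h x)) (at h)"
    using bounded_linear.has_vector_derivative[OF linear_T[OF assms(2)]
        orbit_has_vector_derivative[OF assms(1)]] .
qed (use T_commute assms in auto)

text \<open>A pointwise limit of bounded difference quotients is bounded by the uniform boundedness
  principle. This is where differentiability of every orbit turns into an operator bound.\<close>

lemma clinear_AT:
  assumes "h > 0"
  shows "bounded_clinear (AT h)"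
proof (rule bounded_clinear_limit)
  let ?f = "\<lambda>n x. complex_of_real (real (Suc n)) *\<^sub>C (T (h + inverse (real (Suc n))) x - T h x)"
  show "bounded_clinear (?f n)" for n
  proof -
    have "bounded_clinear (T (h + inverse (real (Suc n))))" "bounded_clinear (T h)"
      using assms by (auto intro!: clinear_T add_nonneg_nonneg)
    then show ?thesis
      unfolding bounded_clinear_def
      by (auto intro!: bounded_linear_sub bounded_linear_compose[OF scaleC.bounded_linear_right]
          simp: scaleC_scaleC complex_vector.scale_right_diff_distrib mult.commute)
  qed
  show "(\<lambda>n. ?f n x) \<longlonglongrightarrow> AT h x" for x
  proof -
    have "((\<lambda>s. (T (s + h) x - T h x) /\<^sub>R s) \<longlongrightarrow> AT h x) (at_right 0)"
      by (rule has_vector_derivative_imp_right_quotient[of _ _ _ "h + 1",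
            OF has_vector_derivative_at_within[OF orbit_has_vector_derivative[OF assms]]]) simp
    moreover have "filterlim (\<lambda>n. inverse (real (Suc n))) (at_right 0) sequentially"
      by (intro tendsto_imp_filterlim_at_right LIMSEQ_inverse_real_of_nat) simp
    ultimately have "(\<lambda>n. (T (inverse (real (Suc n)) + h) x - T h x) /\<^sub>R inverse (real (Suc n)))
        \<longlonglongrightarrow> AT h x"
      by (rule filterlim_compose)
    then show ?thesis by (simp add: scaleR_scaleC add.commute)
  qed
qed

section \<open>The generator\<close>

lemma generator_iff:
  "(x, y) \<in> generator T \<longleftrightarrow> ((\<lambda>h. (T h x - x) /\<^sub>R h) \<longlongrightarrow> y) (at_right 0)"
  by (simp add: generator_def)

lemma generator_unique: "(x, y) \<in> generator T \<Longrightarrow> (x, z) \<in> generator T \<Longrightarrow> y = z"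
  unfolding generator_iff by (rule tendsto_unique) auto

lemma generator_add:
  assumes "(x, y) \<in> generator T" "(x', y') \<in> generator T"
  shows "(x + x', y + y') \<in> generator T"
proof -
  have "((\<lambda>h. (T h x - x) /\<^sub>R h + (T h x' - x') /\<^sub>R h) \<longlongrightarrow> y + y') (at_right 0)"
    using assms unfolding generator_iff by (rule tendsto_add)
  moreover have "\<forall>\<^sub>F h in at_right 0.
      (T h x - x) /\<^sub>R h + (T h x' - x') /\<^sub>R h = (T h (x + x') - (x + x')) /\<^sub>R h"
    using eventually_at_right_less[of 0]
    by eventually_elim (simp add: bounded_clinear_add[OF clinear_T] flip: scaleR_add_right)
  ultimately show ?thesis
    unfolding generator_iff by (rule Lim_transform_eventually)
qed

lemma generator_map:
  assumes f: "bounded_clinear f" and comm: "\<And>s x. s \<ge> 0 \<Longrightarrow> f (T s x) = T s (f x)"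
    and xy: "(x, y) \<in> generator T"
  shows "(f x, f y) \<in> generator T"
proof -
  have lin: "bounded_linear f" using f by (rule bounded_clinear_imp_bounded_linear)
  have "((\<lambda>h. f ((T h x - x) /\<^sub>R h)) \<longlongrightarrow> f y) (at_right 0)"
    using lin xy unfolding generator_iff by (rule bounded_linear.tendsto)
  moreover have "\<forall>\<^sub>F h in at_right 0. f ((T h x - x) /\<^sub>R h) = (T h (f x) - f x) /\<^sub>R h"
    using eventually_at_right_less[of 0]
    by eventually_elim
      (simp add: linear_scale[OF bounded_linear.linear[OF lin]] bounded_clinear_diff[OF f] comm)
  ultimately show ?thesis
    unfolding generator_iff by (rule Lim_transform_eventually)
qed

lemma generator_scaleC: "(x, y) \<in> generator T \<Longrightarrow> (c *\<^sub>C x, c *\<^sub>C y) \<in> generator T"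
  by (rule generator_map)
    (auto simp: bounded_clinear_def scaleC.bounded_linear_right scaleC_scaleC mult.commute
      bounded_clinear_scaleC[OF clinear_T])

text \<open>Integrating the derivative of the orbit of \<open>u\<close> down to time 0 gives
  \<open>T h u - u\<close> as the integral of \<open>T r v\<close>, and dividing by \<open>h\<close>
  gives the right derivative at 0. Membership in the generator can thus be tested at positive times,
  with bounded operators.\<close>

lemma generatorI:
  assumes AT: "\<And>h. h > 0 \<Longrightarrow> AT h u = T h v"
  shows "(u, v) \<in> generator T"
proof -
  have cont: "continuous_on {0..1} (\<lambda>r. T r v)"
    using continuous_on_orbit by (rule continuous_on_subset) auto
  have eq: "integral {0..h} (\<lambda>r. T r v) = T h u - u" if "h > 0" for h
  proof -
    have "((\<lambda>r. T r v) has_integral (T h u - T 0 u)) {0..h}"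
    \<comment> \<open>The interior version is required: differentiability of the orbit of
      \<open>u\<close> at time 0 is just what is being proved.\<close>
    proof (rule fundamental_theorem_of_calculus_interior)
      show "continuous_on {0..h} (\<lambda>r. T r u)"
        using continuous_on_orbit by (rule continuous_on_subset) auto
      show "((\<lambda>r. T r u) has_vector_derivative T r v) (at r)" if "r \<in> {0<..<h}" for r
        using that orbit_has_vector_derivative[of r u] AT by simp
    qed (use that in simp)
    then show ?thesis by (simp add: integral_unique)
  qed
  have "((\<lambda>h. integral {0..h} (\<lambda>r. T r v)) has_vector_derivative T 0 v) (at 0 within {0..1})"
    using cont by (rule integral_has_vector_derivative) simp
  from has_vector_derivative_imp_right_quotient[OF this]
  have "((\<lambda>h. integral {0..h} (\<lambda>r. T r v) /\<^sub>R h) \<longlongrightarrow> v) (at_right 0)"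
    by simp
  moreover have "\<forall>\<^sub>F h in at_right 0. integral {0..h} (\<lambda>r. T r v) /\<^sub>R h = (T h u - u) /\<^sub>R h"
    using eventually_at_right_less[of 0] by eventually_elim (simp add: eq)
  ultimately show ?thesis
    unfolding generator_iff by (rule Lim_transform_eventually)
qed

lemma generator_T: "h > 0 \<Longrightarrow> (T h x, AT h x) \<in> generator T"
  by (rule generatorI) (simp add: AT_T T_AT add.commute)

section \<open>The bicommutant of the semigroup\<close>

definition commutant :: "('a \<Rightarrow> 'a) set"
  where "commutant = {g. bounded_clinear g \<and> (\<forall>s\<ge>0. \<forall>x. g (T s x) = T s (g x))}"

text \<open>The bicommutant is a commutative algebra that contains everything built from the semigroup by
  limits, integrals and inverses.\<close>

definition bicommutant :: "('a \<Rightarrow> 'a) set"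
  where "bicommutant = {f. bounded_clinear f \<and> (\<forall>g\<in>commutant. \<forall>x. f (g x) = g (f x))}"

lemma bicommutantI:
  "bounded_clinear f \<Longrightarrow> (\<And>g x. g \<in> commutant \<Longrightarrow> f (g x) = g (f x)) \<Longrightarrow> f \<in> bicommutant"
  by (simp add: bicommutant_def)

lemma clinear_bicommutant: "f \<in> bicommutant \<Longrightarrow> bounded_clinear f"
  by (simp add: bicommutant_def)

lemma clinear_commutant: "g \<in> commutant \<Longrightarrow> bounded_clinear g"
  by (simp add: commutant_def)

lemma bicommutant_commutant: "f \<in> bicommutant \<Longrightarrow> g \<in> commutant \<Longrightarrow> f (g x) = g (f x)"
  by (simp add: bicommutant_def)

lemma T_bicommutant: "s \<ge> 0 \<Longrightarrow> T s \<in> bicommutant"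
  by (rule bicommutantI) (simp_all add: clinear_T commutant_def)

lemma T_commutant: "s \<ge> 0 \<Longrightarrow> T s \<in> commutant"
  by (simp add: commutant_def clinear_T T_commute)

lemma bicommutant_subset_commutant: "bicommutant \<subseteq> commutant"
  using bicommutant_commutant[OF _ T_commutant] by (auto simp: commutant_def clinear_bicommutant)

lemma bicommutant_commute:
  "f \<in> bicommutant \<Longrightarrow> g \<in> bicommutant \<Longrightarrow> f (g x) = g (f x)"
  using bicommutant_commutant bicommutant_subset_commutant by blast

lemma bicommutant_id: "(\<lambda>x. x) \<in> bicommutant"
  by (rule bicommutantI) (simp_all add: bounded_clinear_ident)

lemma bicommutant_compose:
  assumes "f \<in> bicommutant" "g \<in> bicommutant"
  shows "(\<lambda>x. f (g x)) \<in> bicommutant"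
proof (rule bicommutantI)
  show "f (g (h x)) = h (f (g x))" if "h \<in> commutant" for h x
    by (simp only: bicommutant_commutant[OF assms(1) that] bicommutant_commutant[OF assms(2) that])
qed (rule bounded_clinear_compose[OF assms[THEN clinear_bicommutant]])

lemma bicommutant_scaleC:
  assumes "f \<in> bicommutant"
  shows "(\<lambda>x. c *\<^sub>C f x) \<in> bicommutant"
proof (rule bicommutantI)
  show "c *\<^sub>C f (h x) = h (c *\<^sub>C f x)" if "h \<in> commutant" for h x
    by (simp only: bicommutant_commutant[OF assms that] bounded_clinear_scaleC[OF clinear_commutant[OF that]])
qed (rule bounded_clinear_scaleC_right[OF clinear_bicommutant[OF assms]])

lemma bicommutant_add:
  assumes "f \<in> bicommutant" "g \<in> bicommutant"
  shows "(\<lambda>x. f x + g x) \<in> bicommutant"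
proof (rule bicommutantI)
  show "f (h x) + g (h x) = h (f x + g x)" if "h \<in> commutant" for h x
    by (simp only: bicommutant_commutant[OF assms(1) that] bicommutant_commutant[OF assms(2) that]
        bounded_clinear_add[OF clinear_commutant[OF that]])
qed (rule bounded_clinear_plus[OF assms[THEN clinear_bicommutant]])

lemma bicommutant_diff:
  assumes "f \<in> bicommutant" "g \<in> bicommutant"
  shows "(\<lambda>x. f x - g x) \<in> bicommutant"
proof -
  have "(\<lambda>x. f x + (- 1) *\<^sub>C g x) \<in> bicommutant"
    by (rule bicommutant_add[OF assms(1) bicommutant_scaleC[OF assms(2)]])
  then show ?thesis by (simp add: complex_vector.scale_minus_left scaleC_one)
qed

lemma AT_bicommutant:
  assumes "h > 0"
  shows "AT h \<in> bicommutant"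
proof (rule bicommutantI)
  show "bounded_clinear (AT h)" using assms by (rule clinear_AT)
  fix g x assume g: "g \<in> commutant"
  show "AT h (g x) = g (AT h x)"
  proof (rule has_vector_derivative_unique_orbit[OF assms, symmetric])
    show "((\<lambda>s. g (T s x)) has_vector_derivative g (AT h x)) (at h)"
      using bounded_clinear_imp_bounded_linear[OF clinear_commutant[OF g]]
        orbit_has_vector_derivative[OF assms] by (rule bounded_linear.has_vector_derivative)
  qed (use g in \<open>simp add: commutant_def\<close>)
qed

lemma generator_bicommutant:
  "f \<in> bicommutant \<Longrightarrow> (x, y) \<in> generator T \<Longrightarrow> (f x, f y) \<in> generator T"
  using generator_map clinear_bicommutant bicommutant_commutant T_commutant by metis

text \<open>The solution of \<open>f u = y\<close> is the fixed point of the contraction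
  \<open>u \<mapsto> y + (u - f u)\<close>. Linearity of the inverse and its commutation with the
  commutant both follow by applying \<open>f\<close> and cancelling it by injectivity.\<close>

lemma bicommutant_inverse:
  assumes f: "f \<in> bicommutant" and q: "q < 1" and small: "\<And>x. norm (x - f x) \<le> q * norm x"
  obtains g where "g \<in> bicommutant" "\<And>x. f (g x) = x" "\<And>x. g (f x) = x"
proof -
  have lin: "bounded_clinear f" using f by (rule clinear_bicommutant)
  note lin_f = bounded_clinear_add[OF lin] bounded_clinear_diff[OF lin] bounded_clinear_scaleC[OF lin]
  have lower: "(1 - q) * norm x \<le> norm (f x)" for x
    using small[of x] norm_triangle_ineq2[of x "x - f x"] by (simp add: algebra_simps)
  have inj: "x = y" if "f x = f y" for x y
    using lower[of "x - y"] that q by (simp add: lin_f) (smt (verit) mult_pos_pos zero_less_norm_iff right_minus_eq)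
  have "\<exists>x. f x = y" for y
  proof -
    \<comment> \<open>A negative \<open>q\<close> is allowed by the hypotheses, but a contraction
      constant has to be nonnegative.\<close>
    have "0 \<le> max q 0" "max q 0 < 1" using q by auto
    moreover have "dist (y + (u - f u)) (y + (v - f v)) \<le> max q 0 * dist u v" for u v
    proof -
      have "dist (y + (u - f u)) (y + (v - f v)) = norm ((u - v) - f (u - v))"
        by (simp add: dist_norm lin_f algebra_simps)
      also have "\<dots> \<le> max q 0 * norm (u - v)"
        using small[of "u - v"] by (smt (verit) mult_right_mono norm_ge_zero)
      finally show ?thesis by (simp add: dist_norm)
    qed
    ultimately have "\<exists>!u. y + (u - f u) = u"
      using banach_fix_type[of "max q 0" "\<lambda>u. y + (u - f u)"] by blast
    then obtain u where "y + (u - f u) = u" by blast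
    then show ?thesis by (intro exI[of _ u]) (simp add: algebra_simps)
  qed
  then obtain g where fg: "\<And>y. f (g y) = y" by metis
  have gf: "g (f x) = x" for x
    by (rule inj) (simp add: fg)
  have "bounded_linear g"
  proof (rule bounded_linear_intro)
    show "g (x + y) = g x + g y" for x y by (rule inj) (simp add: fg lin_f)
    show "g (r *\<^sub>R x) = r *\<^sub>R g x" for r x
      by (rule inj) (simp add: fg lin_f scaleR_scaleC)
    show "norm (g x) \<le> norm x * (1 / (1 - q))" for x
      using lower[of "g x"] q by (simp add: fg field_simps)
  qed
  moreover have "g (c *\<^sub>C x) = c *\<^sub>C g x" for c x
    by (rule inj) (simp add: fg lin_f)
  moreover have "g (h x) = h (g x)" if "h \<in> commutant" for h x
    by (rule inj) (simp add: fg bicommutant_commutant[OF f that])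
  ultimately have "g \<in> bicommutant"
    by (intro bicommutantI) (auto simp: bounded_clinear_def)
  then show thesis using that fg gf by blast
qed

subsection \<open>Weighted integrals of orbits\<close>

definition orbit_integral :: "real \<Rightarrow> (real \<Rightarrow> complex) \<Rightarrow> 'a \<Rightarrow> 'a"
  where "orbit_integral a \<phi> x = integral {0..a} (\<lambda>s. \<phi> s *\<^sub>C T s x)"

lemma continuous_on_T: "continuous_on {0..a} (\<lambda>s. T s x)"
  using continuous_on_orbit by (rule continuous_on_subset) auto

lemma orbit_integrable:
  assumes "continuous_on {0..a} \<phi>"
  shows "(\<lambda>s. \<phi> s *\<^sub>C T s x) integrable_on {0..a}"
  using assms continuous_on_T by (intro integrable_continuous_real scaleC.continuous_on)

lemma bounded_linear_orbit_integral:
  assumes "continuous_on {0..a} \<phi>" "bounded_linear g"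
  shows "g (orbit_integral a \<phi> x) = integral {0..a} (\<lambda>s. g (\<phi> s *\<^sub>C T s x))"
  unfolding orbit_integral_def using integral_linear[OF orbit_integrable[OF assms(1)] assms(2)]
  by (simp add: o_def)

lemma clinear_orbit_integral:
  assumes "continuous_on {0..a} \<phi>" "bounded_clinear g"
  shows "g (orbit_integral a \<phi> x) = integral {0..a} (\<lambda>s. \<phi> s *\<^sub>C g (T s x))"
  using bounded_linear_orbit_integral[OF assms(1) bounded_clinear_imp_bounded_linear[OF assms(2)]]
  by (simp add: bounded_clinear_scaleC[OF assms(2)])

lemma orbit_integral_bicommutant:
  assumes cont: "continuous_on {0..a} \<phi>" and a: "a \<ge> 0"
  shows "orbit_integral a \<phi> \<in> bicommutant"
proof (rule bicommutantI)
  obtain M where M: "M > 0" "\<And>s x. 0 \<le> s \<Longrightarrow> s \<le> a \<Longrightarrow> norm (T s x) \<le> M * norm x"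
    using bounded_T by blast
  have "bounded (\<phi> ` {0..a})"
    using cont by (intro compact_imp_bounded compact_continuous_image) auto
  then obtain K where K: "\<And>s. s \<in> {0..a} \<Longrightarrow> norm (\<phi> s) \<le> K"
    unfolding bounded_iff by blast
  have comm: "orbit_integral a \<phi> (g x) = g (orbit_integral a \<phi> x)"
    if "bounded_clinear g" "\<And>s x. s \<ge> 0 \<Longrightarrow> g (T s x) = T s (g x)" for g x
    using clinear_orbit_integral[OF cont that(1)] that(2)
    by (auto simp: orbit_integral_def intro!: integral_cong)
  then show "orbit_integral a \<phi> (g x) = g (orbit_integral a \<phi> x)" if "g \<in> commutant" for g x
    using that by (simp add: commutant_def)
  have scale: "orbit_integral a \<phi> (c *\<^sub>C x) = c *\<^sub>C orbit_integral a \<phi> x" for c x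
    by (rule comm) (auto simp: bounded_clinear_def scaleC.bounded_linear_right scaleC_scaleC
        mult.commute bounded_clinear_scaleC[OF clinear_T])
  have "bounded_linear (orbit_integral a \<phi>)"
  proof (rule bounded_linear_intro)
    show "orbit_integral a \<phi> (x + y) = orbit_integral a \<phi> x + orbit_integral a \<phi> y" for x y
      unfolding orbit_integral_def
      by (subst integral_add[symmetric])
        (auto intro!: integral_cong orbit_integrable cont
          simp: bounded_clinear_add[OF clinear_T] scaleC_add_right)
    show "orbit_integral a \<phi> (r *\<^sub>R x) = r *\<^sub>R orbit_integral a \<phi> x" for r x
      by (simp add: scaleR_scaleC scale)
    show "norm (orbit_integral a \<phi> x) \<le> norm x * (K * M * a)" for x
    proof -
      have "norm (\<phi> s *\<^sub>C T s x) \<le> K * (M * norm x)" if "s \<in> {0..a}" for s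
        unfolding norm_scaleC using K[OF that] order_trans[OF norm_ge_zero K[OF that]] M(2) that
        by (intro mult_mono) auto
      then have "norm (orbit_integral a \<phi> x) \<le> K * (M * norm x) * (a - 0)"
        unfolding orbit_integral_def
        by (intro integral_bound[OF a scaleC.continuous_on[OF cont continuous_on_T]]) auto
      then show ?thesis by (simp add: mult_ac)
    qed
  qed
  then show "bounded_clinear (orbit_integral a \<phi>)"
    using scale by (simp add: bounded_clinear_def)
qed

lemma orbit_integral_add:
  assumes "continuous_on {0..a} \<phi>" "continuous_on {0..a} \<psi>"
  shows "orbit_integral a (\<lambda>s. \<phi> s + \<psi> s) x = orbit_integral a \<phi> x + orbit_integral a \<psi> x"
  unfolding orbit_integral_def
  by (subst integral_add[symmetric]) (auto simp: scaleC_add_left intro!: orbit_integrable assms)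

lemma orbit_integral_scale:
  assumes "continuous_on {0..a} \<phi>"
  shows "orbit_integral a (\<lambda>s. c * \<phi> s) x = c *\<^sub>C orbit_integral a \<phi> x"
  using bounded_linear_orbit_integral[OF assms scaleC.bounded_linear_right]
  by (simp add: orbit_integral_def scaleC_scaleC)

text \<open>Since \<open>AT h\<close> is bounded it may be taken under the integral, where it acts as differentiation;
  this replaces the closedness of the generator.\<close>

lemma generator_orbit_integral:
  assumes a: "a \<ge> 0" and deriv: "\<And>s. (\<phi> has_vector_derivative \<phi>' s) (at s)"
    and cont': "continuous_on {0..a} \<phi>'"
  shows "(orbit_integral a \<phi> x,
    \<phi> a *\<^sub>C T a x - \<phi> 0 *\<^sub>C x - orbit_integral a \<phi>' x) \<in> generator T"
proof (rule generatorI)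
  fix h :: real assume h: "h > 0"
  have cont: "continuous_on {0..a} \<phi>"
    using deriv has_vector_derivative_continuous continuous_at_imp_continuous_on by blast
  have lin: "bounded_clinear (T h)" using h by (intro clinear_T) simp
  have ftc: "((\<lambda>s. \<phi> s *\<^sub>C AT (h + s) x + \<phi>' s *\<^sub>C T (h + s) x) has_integral
      (\<phi> a *\<^sub>C T (h + a) x - \<phi> 0 *\<^sub>C T (h + 0) x)) {0..a}"
  proof (rule fundamental_theorem_of_calculus[OF a])
    fix s assume "s \<in> {0..a}"
    then show "((\<lambda>s. \<phi> s *\<^sub>C T (h + s) x) has_vector_derivative
        \<phi> s *\<^sub>C AT (h + s) x + \<phi>' s *\<^sub>C T (h + s) x) (at s within {0..a})"
      using h by (intro has_vector_derivative_at_within[OF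
            bounded_bilinear.has_vector_derivative[OF bounded_bilinear_scaleC deriv
              shifted_orbit_has_vector_derivative]]) auto
  qed
  have "((\<lambda>s. \<phi>' s *\<^sub>C T s (T h x)) has_integral orbit_integral a \<phi>' (T h x)) {0..a}"
    unfolding orbit_integral_def by (intro integrable_integral orbit_integrable cont')
  moreover have "orbit_integral a \<phi>' (T h x) = T h (orbit_integral a \<phi>' x)"
    using h a by (intro bicommutant_commute orbit_integral_bicommutant cont' T_bicommutant) auto
  ultimately have "((\<lambda>s. \<phi>' s *\<^sub>C T (h + s) x) has_integral T h (orbit_integral a \<phi>' x)) {0..a}"
    by (rule_tac has_integral_eq[rotated]) (use h in \<open>auto simp: T_add T_commute\<close>)
  from has_integral_diff[OF ftc this]
  have "((\<lambda>s. \<phi> s *\<^sub>C AT (h + s) x) has_integral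
      (\<phi> a *\<^sub>C T (h + a) x - \<phi> 0 *\<^sub>C T (h + 0) x - T h (orbit_integral a \<phi>' x))) {0..a}"
    by simp
  moreover have "AT h (orbit_integral a \<phi> x) = integral {0..a} (\<lambda>s. \<phi> s *\<^sub>C AT (h + s) x)"
    using clinear_orbit_integral[OF cont clinear_AT[OF h], of x] h
    by (auto simp: AT_T intro!: integral_cong)
  ultimately show "AT h (orbit_integral a \<phi> x) =
      T h (\<phi> a *\<^sub>C T a x - \<phi> 0 *\<^sub>C x - orbit_integral a \<phi>' x)"
    using h a by (simp add: integral_unique bounded_clinear_simps[OF lin] T_add)
qed

subsection \<open>Factorization of \<open>T a - \<mu>\<close>\<close>

lemma shift_iff: "(x, y) \<in> shift S l \<longleftrightarrow> (x, y + l *\<^sub>C x) \<in> S"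
  unfolding shift_def by (auto simp: algebra_simps)

text \<open>The integral of \<open>exp (l (a - s)) T s\<close> over \<open>[0, a]\<close>. The
  leading exponential is normalised so that \<open>A - l\<close> times this operator is exactly
  \<open>T a - exp (l a)\<close>.\<close>

definition factor :: "real \<Rightarrow> complex \<Rightarrow> 'a \<Rightarrow> 'a"
  where "factor a l x = exp (l * of_real a) *\<^sub>C orbit_integral a (\<lambda>s. exp (- l * of_real s)) x"

lemma continuous_on_exp_weight: "continuous_on S (\<lambda>s. exp (- l * complex_of_real s))"
  by (intro continuous_intros)

lemma factor_bicommutant: "a \<ge> 0 \<Longrightarrow> factor a l \<in> bicommutant"
  unfolding factor_def
  by (intro bicommutant_scaleC orbit_integral_bicommutant continuous_on_exp_weight)

lemma exp_weight_has_vector_derivative: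
  "((\<lambda>s. exp (- l * complex_of_real s)) has_vector_derivative - l * exp (- l * of_real s)) (at s)"
  by (rule has_vector_derivative_real_field) (auto intro!: derivative_eq_intros)

lemma shift_factor:
  assumes "a \<ge> 0"
  shows "(factor a l x, T a x - exp (l * of_real a) *\<^sub>C x) \<in> shift (generator T) l"
proof -
  let ?I = "orbit_integral a (\<lambda>s. exp (- l * of_real s)) x"
  have "(?I, exp (- l * of_real a) *\<^sub>C T a x - x + l *\<^sub>C ?I) \<in> generator T"
    using generator_orbit_integral[OF assms exp_weight_has_vector_derivative[of l], of x]
    by (simp only: orbit_integral_scale[OF continuous_on_exp_weight])
      (simp add: scaleC_one continuous_intros complex_vector.scale_minus_left)
  from generator_scaleC[OF this, of "exp (l * of_real a)"] show ?thesis
    unfolding shift_iff factor_def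
    by (simp add: algebra_simps complex_vector.scale_right_diff_distrib scaleC_add_right scaleC_scaleC scaleC_one exp_minus)
qed

text \<open>The linear factor in \<open>\<phi>\<close> is chosen by its boundary values:
  \<open>\<phi> a = 0\<close> removes \<open>T a x\<close>, and \<open>\<phi> 0 = - 1\<close> leaves
  \<open>x\<close>. Its slope \<open>1 / a\<close> makes \<open>\<phi>' + l \<phi>\<close> equal to
  \<open>exp (- l s) / a\<close>, whose orbit integral is the stated multiple of
  \<open>factor a l\<close>.\<close>

lemma shift_cofactor:
  fixes l :: complex
  assumes "a > 0"
  defines "\<phi> \<equiv> \<lambda>s. of_real ((s - a) / a) * exp (- l * of_real s)"
  shows "(orbit_integral a \<phi> x, x - (1 / (a * exp (l * of_real a))) *\<^sub>C factor a l x)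
    \<in> shift (generator T) l"
proof -
  let ?e = "\<lambda>s. exp (- l * complex_of_real s)"
  have cont: "continuous_on {0..a} \<phi>" unfolding \<phi>_def by (intro continuous_intros) (use assms in auto)
  have "(\<phi> has_vector_derivative (1 / of_real a) * ?e s + (- l) * \<phi> s) (at s)" for s
  proof -
    have "(\<phi> has_vector_derivative
        of_real ((s - a) / a) * (- l * ?e s) + of_real (1 / a) * ?e s) (at s)"
      unfolding \<phi>_def
      by (intro has_vector_derivative_mult exp_weight_has_vector_derivative has_vector_derivative_of_real)
        (use assms(1) in \<open>auto intro!: derivative_eq_intros\<close>)
    moreover have "of_real ((s - a) / a) * (- l * ?e s) + of_real (1 / a) * ?e s =
        (1 / of_real a) * ?e s + (- l) * \<phi> s"
      by (simp add: \<phi>_def)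
    ultimately show ?thesis by (simp only:)
  qed
  moreover have "continuous_on {0..a} (\<lambda>s. (1 / of_real a) * ?e s + (- l) * \<phi> s)"
    by (intro continuous_intros cont)
  ultimately have "(orbit_integral a \<phi> x, \<phi> a *\<^sub>C T a x - \<phi> 0 *\<^sub>C x -
      orbit_integral a (\<lambda>s. (1 / of_real a) * ?e s + (- l) * \<phi> s) x) \<in> generator T"
    using assms by (intro generator_orbit_integral) auto
  also have "orbit_integral a (\<lambda>s. (1 / of_real a) * ?e s + (- l) * \<phi> s) x =
      (1 / (a * exp (l * of_real a))) *\<^sub>C factor a l x - l *\<^sub>C orbit_integral a \<phi> x"
  proof -
    have "orbit_integral a (\<lambda>s. (1 / of_real a) * ?e s + (- l) * \<phi> s) x =
        orbit_integral a (\<lambda>s. (1 / of_real a) * ?e s) x + orbit_integral a (\<lambda>s. (- l) * \<phi> s) x"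
      by (intro orbit_integral_add continuous_intros cont)
    also have "\<dots> = (1 / of_real a) *\<^sub>C orbit_integral a ?e x + (- l) *\<^sub>C orbit_integral a \<phi> x"
      by (simp only: orbit_integral_scale[OF cont] orbit_integral_scale[OF continuous_on_exp_weight])
    finally show ?thesis
      by (simp add: factor_def scaleC_scaleC complex_vector.scale_minus_left)
  qed
  finally show ?thesis
    using assms(1) unfolding shift_iff by (simp add: \<phi>_def complex_vector.scale_minus_left scaleC_one algebra_simps)
qed

lemma operator_factorization_factor:
  fixes l \<mu> :: complex
  assumes a: "a > 0" and \<mu>: "exp (l * of_real a) = \<mu>"
  defines "C \<equiv> orbit_integral a (\<lambda>s. of_real ((s - a) / a) * exp (- l * of_real s))"
  shows "operator_factorization (shift (generator T) l) (\<lambda>x. T a x - \<mu> *\<^sub>C x)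
    (factor a l) C (1 / (a * \<mu>))"
proof
  let ?S = "shift (generator T) l"
  have C: "C \<in> bicommutant"
    unfolding C_def using a by (intro orbit_integral_bicommutant continuous_intros) auto
  have B: "factor a l \<in> bicommutant"
    using a by (intro factor_bicommutant) simp
  show "single_valued ?S"
    unfolding single_valued_def shift_iff by (metis add_right_cancel generator_unique)
  show "(x + x', y + y') \<in> ?S" if "(x, y) \<in> ?S" "(x', y') \<in> ?S" for x y x' y'
    using generator_add[OF that[unfolded shift_iff]] by (simp add: shift_iff scaleC_add_right algebra_simps)
  show "(c *\<^sub>C x, c *\<^sub>C y) \<in> ?S" if "(x, y) \<in> ?S" for x y c
    using generator_scaleC[OF that[unfolded shift_iff], of c]
    by (simp add: shift_iff scaleC_add_right scaleC_scaleC mult.commute)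
  have comm: "(f x, f y) \<in> ?S" if "f \<in> bicommutant" "(x, y) \<in> ?S" for f x y
    using generator_bicommutant[OF that[unfolded shift_iff]]
    by (simp add: shift_iff bounded_clinear_simps[OF clinear_bicommutant[OF that(1)]])
  show "(factor a l x, factor a l y) \<in> ?S" "(C x, C y) \<in> ?S" if "(x, y) \<in> ?S" for x y
    using comm B C that by blast+
  show "(factor a l x, T a x - \<mu> *\<^sub>C x) \<in> ?S" for x
    using shift_factor[of a l x] a \<mu> by simp
  show "(C x, x - (1 / (a * \<mu>)) *\<^sub>C factor a l x) \<in> ?S" for x
    using shift_cofactor[OF a, of l x] \<mu> by (simp add: C_def)
  show "bounded_clinear (\<lambda>x. T a x - \<mu> *\<^sub>C x)"
    using a by (intro clinear_bicommutant bicommutant_diff T_bicommutant bicommutant_scaleC bicommutant_id) simp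
  show "bounded_clinear (factor a l)" "bounded_clinear C"
    using B C by (simp_all add: clinear_bicommutant)
qed

end

section \<open>The kernel \<open>sin^(2 n)\<close>\<close>

text \<open>Wallis recursion: \<open>sin^(2n+1) cos\<close> vanishes at both ends of the half
  period, and its derivative combines two consecutive even powers of the sine.\<close>

lemma sin_power_integral_Suc:
  fixes a :: real
  assumes "a > 0"
  defines "c \<equiv> \<lambda>n. integral {0..a} (\<lambda>s. sin (pi * s / a) ^ (2 * n))"
  shows "(2 * real n + 2) * c (Suc n) = (2 * real n + 1) * c n"
proof -
  let ?w = "\<lambda>s. pi * s / a"
  let ?f = "\<lambda>n s. sin (?w s) ^ (2 * n)"
  have int: "?f n integrable_on {0..a}" for n
    by (intro integrable_continuous_real continuous_intros) (use assms(1) in auto)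
  have ftc: "((\<lambda>s. (pi / a) * ((2 * real n + 1) * ?f n s - (2 * real n + 2) * ?f (Suc n) s)) has_integral
      (sin (?w a) ^ (2 * n + 1) * cos (?w a) - sin (?w 0) ^ (2 * n + 1) * cos (?w 0))) {0..a}"
  proof (rule fundamental_theorem_of_calculus)
    fix s
    have "((\<lambda>s. sin (?w s) ^ (2 * n + 1) * cos (?w s)) has_real_derivative
        (2 * real n + 1) * sin (?w s) ^ (2 * n) * (cos (?w s) * (pi / a)) * cos (?w s)
        + sin (?w s) ^ (2 * n + 1) * (- sin (?w s) * (pi / a))) (at s)"
    proof -
      have "((\<lambda>s. sin (?w s)) has_real_derivative cos (?w s) * (pi / a)) (at s)"
        "((\<lambda>s. cos (?w s)) has_real_derivative - sin (?w s) * (pi / a)) (at s)"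
        using assms(1) by (auto intro!: derivative_eq_intros)
      from DERIV_mult[OF DERIV_power_Suc[OF this(1), of "2 * n"] this(2)] show ?thesis
        by (simp add: algebra_simps add_divide_distrib)
    qed
    moreover have "(2 * real n + 1) * sin (?w s) ^ (2 * n) * (cos (?w s) * (pi / a)) * cos (?w s)
        + sin (?w s) ^ (2 * n + 1) * (- sin (?w s) * (pi / a)) =
        (pi / a) * ((2 * real n + 1) * (?f n s * (cos (?w s))\<^sup>2) - ?f (Suc n) s)"
      by (simp add: algebra_simps power2_eq_square)
    moreover have "\<dots> = (pi / a) * ((2 * real n + 1) * ?f n s - (2 * real n + 2) * ?f (Suc n) s)"
      unfolding cos_squared_eq by (simp add: algebra_simps power2_eq_square)
    ultimately show "((\<lambda>s. sin (?w s) ^ (2 * n + 1) * cos (?w s)) has_vector_derivative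
        (pi / a) * ((2 * real n + 1) * ?f n s - (2 * real n + 2) * ?f (Suc n) s)) (at s within {0..a})"
      by (simp only: has_real_derivative_iff_has_vector_derivative has_vector_derivative_at_within)
  qed (use assms(1) in simp)
  have "integral {0..a} (\<lambda>s. (pi / a) * ((2 * real n + 1) * ?f n s - (2 * real n + 2) * ?f (Suc n) s)) = 0"
    unfolding integral_unique[OF ftc] using assms(1) by simp
  also have "integral {0..a} (\<lambda>s. (pi / a) * ((2 * real n + 1) * ?f n s - (2 * real n + 2) * ?f (Suc n) s)) =
      (pi / a) * ((2 * real n + 1) * c n - (2 * real n + 2) * c (Suc n))"
    unfolding c_def integral_mult_right
    by (subst integral_diff) (auto intro!: integrable_on_mult_right int simp del: mult_Suc_right)
  finally show ?thesis using assms(1) by simp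
qed

text \<open>With \<open>w = pi s / a\<close> the exponentials are the steps between neighbouring
  frequencies of the fibre, so multiplying by the squared sine mixes frequency \<open>k\<close> with
  \<open>k - 1\<close> and \<open>k + 1\<close> only.\<close>

lemma of_real_sin_squared:
  "complex_of_real ((sin w)\<^sup>2) =
    1 / 2 + (- 1 / 4) * (exp (- (2 * \<i> * of_real w)) + exp (2 * \<i> * of_real w))"
proof -
  have "complex_of_real ((sin w)\<^sup>2) = (1 - cos (2 * of_real w)) / 2"
    by (simp add: cos_double_sin flip: sin_of_real)
  then show ?thesis
    by (simp add: cos_exp_eq field_simps)
qed

text \<open>By the recursion, the integral of \<open>sin^(2n) cos^2\<close> is
  \<open>c n / (2 n + 2)\<close>, a vanishing fraction of the mass \<open>c n\<close>. The cosine is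
  zero only at the centre, so \<open>cos^2\<close> controls the distance to \<open>a / 2\<close> up
  to an error \<open>\<epsilon> / 2\<close>.\<close>

lemma sin_power_concentrates:
  fixes a \<epsilon> :: real
  assumes a: "a > 0" and \<epsilon>: "\<epsilon> > 0"
  obtains n where "integral {0..a} (\<lambda>s. sin (pi * s / a) ^ (2 * n)) > 0"
    "integral {0..a} (\<lambda>s. sin (pi * s / a) ^ (2 * n) * \<bar>s - a / 2\<bar>)
      \<le> \<epsilon> * integral {0..a} (\<lambda>s. sin (pi * s / a) ^ (2 * n))"
proof -
  let ?f = "\<lambda>n s. sin (pi * s / a) ^ (2 * n)"
  define c where "c n = integral {0..a} (?f n)" for n
  have int: "?f n integrable_on {0..a}" for n
    by (intro integrable_continuous_real continuous_intros) (use a in auto)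
  have rec: "(2 * real n + 2) * c (Suc n) = (2 * real n + 1) * c n" for n
    unfolding c_def by (rule sin_power_integral_Suc[OF a])
  have pos: "c n > 0" for n
  proof (induction n)
    case 0
    show ?case using a by (simp add: c_def)
  next
    case (Suc n)
    then have "(2 * real n + 2) * c (Suc n) > 0" by (simp only: rec) simp
    then show ?case by (simp add: zero_less_mult_iff)
  qed
  have diff: "c n - c (Suc n) \<le> c n / (2 * real n + 2)" for n
    using rec[of n] by (simp add: field_simps)
  define K where "K = {s \<in> {0..a}. \<bar>s - a / 2\<bar> \<ge> \<epsilon> / 2}"
  \<comment> \<open>Away from the centre, on the compact set \<open>K\<close>, \<open>cos^2\<close>
    has a positive minimum \<open>m\<close>; as the distance is at most \<open>a\<close>, the
    constant \<open>C = a / m\<close> works.\<close>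
  have "\<exists>C\<ge>0. \<forall>s\<in>{0..a}. \<bar>s - a / 2\<bar> \<le> \<epsilon> / 2 + C * (cos (pi * s / a))\<^sup>2"
  proof (cases "K = {}")
    case True
    then show ?thesis by (intro exI[of _ 0]) (force simp: K_def)
  next
    case False
    have "compact K"
    proof -
      have "K = {0..a} \<inter> {s. \<bar>s - a / 2\<bar> \<ge> \<epsilon> / 2}" by (auto simp: K_def)
      moreover have "closed {s. \<bar>s - a / 2\<bar> \<ge> \<epsilon> / 2}"
        by (intro closed_Collect_le continuous_intros)
      ultimately show ?thesis by (simp add: compact_Int_closed)
    qed
    moreover have "continuous_on K (\<lambda>s. (cos (pi * s / a))\<^sup>2)"
      by (intro continuous_intros) (use a in auto)
    ultimately obtain s0 where s0: "s0 \<in> K" "\<And>s. s \<in> K \<Longrightarrow> (cos (pi * s0 / a))\<^sup>2 \<le> (cos (pi * s / a))\<^sup>2"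
      using continuous_attains_inf[OF _ False] by blast
    let ?m = "(cos (pi * s0 / a))\<^sup>2"
    have "cos (pi * s0 / a) \<noteq> 0"
    proof
      assume "cos (pi * s0 / a) = 0"
      then have cos_eq: "cos (pi * s0 / a) = cos (pi / 2)" by simp
      have "0 \<le> s0" "s0 \<le> a" using s0(1) by (simp_all add: K_def)
      then have "0 \<le> pi * s0 / a" "pi * s0 / a \<le> pi"
        using a by (simp_all add: divide_le_eq)
      then have "pi * s0 / a = pi / 2"
        by (rule cos_inj_pi[OF _ _ _ _ cos_eq]) simp_all
      then have "s0 = a / 2" using a by (simp add: field_simps)
      then show False using s0(1) \<epsilon> by (simp add: K_def)
    qed
    then have m: "?m > 0" by simp
    have "\<bar>s - a / 2\<bar> \<le> \<epsilon> / 2 + (a / ?m) * (cos (pi * s / a))\<^sup>2" if "s \<in> {0..a}" for s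
    proof (cases "s \<in> K")
      case True
      have "\<bar>s - a / 2\<bar> \<le> a" using that by (auto simp: abs_if)
      also have "a = (a / ?m) * ?m" using m by simp
      also have "\<dots> \<le> (a / ?m) * (cos (pi * s / a))\<^sup>2"
        using s0(2)[OF True] a m by (intro mult_left_mono) auto
      finally show ?thesis using \<epsilon> by simp
    next
      case False
      then have "\<bar>s - a / 2\<bar> \<le> \<epsilon> / 2" using that by (simp add: K_def)
      moreover have "(a / ?m) * (cos (pi * s / a))\<^sup>2 \<ge> 0"
        using a m by (intro mult_nonneg_nonneg) auto
      ultimately show ?thesis by linarith
    qed
    moreover have "a / ?m \<ge> 0" using a m by simp
    ultimately show ?thesis by blast
  qed
  then obtain C where C: "C \<ge> 0"
    "\<And>s. s \<in> {0..a} \<Longrightarrow> \<bar>s - a / 2\<bar> \<le> \<epsilon> / 2 + C * (cos (pi * s / a))\<^sup>2" by blast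
  \<comment> \<open>This size of \<open>n\<close> yields
    \<open>C / (2 n + 2) \<le> \<epsilon> / 2\<close>, the other half of the error.\<close>
  obtain n where n: "C / \<epsilon> \<le> real n" using real_arch_simple by blast
  have "integral {0..a} (\<lambda>s. ?f n s * \<bar>s - a / 2\<bar>) \<le>
      integral {0..a} (\<lambda>s. (\<epsilon> / 2) * ?f n s + C * (?f n s - ?f (Suc n) s))"
  proof (rule integral_le)
    show "(\<lambda>s. ?f n s * \<bar>s - a / 2\<bar>) integrable_on {0..a}"
      by (intro integrable_continuous_real continuous_intros) (use a in auto)
    show "(\<lambda>s. (\<epsilon> / 2) * ?f n s + C * (?f n s - ?f (Suc n) s)) integrable_on {0..a}"
      by (intro integrable_add integrable_diff integrable_on_mult_right int)
    fix s assume "s \<in> {0..a}"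
    then have "?f n s * \<bar>s - a / 2\<bar> \<le> ?f n s * (\<epsilon> / 2 + C * (cos (pi * s / a))\<^sup>2)"
      by (intro mult_left_mono C) auto
    also have "\<dots> = (\<epsilon> / 2) * ?f n s + C * (?f n s - ?f (Suc n) s)"
      unfolding cos_squared_eq by (simp add: algebra_simps power2_eq_square)
    finally show "?f n s * \<bar>s - a / 2\<bar> \<le> (\<epsilon> / 2) * ?f n s + C * (?f n s - ?f (Suc n) s)" .
  qed
  also have "\<dots> = (\<epsilon> / 2) * c n + C * (c n - c (Suc n))"
    unfolding c_def
    by (subst integral_add) (auto intro!: integrable_diff integrable_on_mult_right int
        simp: integral_diff[OF int int] simp del: mult_Suc_right)
  also have "\<dots> \<le> (\<epsilon> / 2) * c n + C * (c n / (2 * real n + 2))"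
    using mult_left_mono[OF diff C(1)] by simp
  also have "C * (c n / (2 * real n + 2)) \<le> (\<epsilon> / 2) * c n"
  proof -
    have "C / (2 * real n + 2) \<le> \<epsilon> / 2"
      using n \<epsilon> by (simp add: field_simps)
    then show ?thesis using mult_right_mono[of "C / (2 * real n + 2)" "\<epsilon> / 2" "c n"] pos[of n]
      by (simp add: field_simps)
  qed
  finally show thesis
    using that[of n] pos[of n] by (simp add: c_def)
qed

section \<open>A Bezout identity\<close>

context diff_semigroup
begin

text \<open>The ideal of the commutative algebra \<open>bicommutant\<close> generated by the factors
  over \<open>F\<close> and \<open>T a - \<mu>\<close>. Hiding the coefficients leaves only closure
  properties to use until the identity itself is shown to belong.\<close>

definition bezout_ideal :: "real \<Rightarrow> complex \<Rightarrow> complex set \<Rightarrow> ('a \<Rightarrow> 'a) \<Rightarrow> bool"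
  where "bezout_ideal a \<mu> F f \<longleftrightarrow> (\<exists>Q V. (\<forall>l\<in>F. Q l \<in> bicommutant) \<and> V \<in> bicommutant \<and>
    (\<forall>x. f x = (\<Sum>l\<in>F. factor a l (Q l x)) + (T a (V x) - \<mu> *\<^sub>C V x)))"

lemma zero_bicommutant: "(\<lambda>x. 0) \<in> bicommutant"
  using bicommutant_scaleC[OF bicommutant_id, of 0] by simp

lemma bezout_ideal_add:
  assumes a: "a \<ge> 0" and f: "bezout_ideal a \<mu> F f" and g: "bezout_ideal a \<mu> F g"
  shows "bezout_ideal a \<mu> F (\<lambda>x. f x + g x)"
proof -
  obtain Q V where QV: "\<And>l. l \<in> F \<Longrightarrow> Q l \<in> bicommutant" "V \<in> bicommutant"
    "\<And>x. f x = (\<Sum>l\<in>F. factor a l (Q l x)) + (T a (V x) - \<mu> *\<^sub>C V x)"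
    using f unfolding bezout_ideal_def by blast
  obtain R W where RW: "\<And>l. l \<in> F \<Longrightarrow> R l \<in> bicommutant" "W \<in> bicommutant"
    "\<And>x. g x = (\<Sum>l\<in>F. factor a l (R l x)) + (T a (W x) - \<mu> *\<^sub>C W x)"
    using g unfolding bezout_ideal_def by blast
  show ?thesis
    unfolding bezout_ideal_def
  proof (intro exI conjI ballI allI)
    show "(\<lambda>x. Q l x + R l x) \<in> bicommutant" if "l \<in> F" for l
      using QV(1)[OF that] RW(1)[OF that] by (rule bicommutant_add)
    show "(\<lambda>x. V x + W x) \<in> bicommutant"
      using QV(2) RW(2) by (rule bicommutant_add)
    show "f x + g x = (\<Sum>l\<in>F. factor a l (Q l x + R l x)) + (T a (V x + W x) - \<mu> *\<^sub>C (V x + W x))" for x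
      using a unfolding QV(3) RW(3)
      by (simp add: bounded_clinear_add[OF clinear_bicommutant[OF factor_bicommutant]]
          bounded_clinear_add[OF clinear_T] sum.distrib scaleC_add_right)
  qed
qed

lemma bezout_ideal_compose:
  assumes f: "bezout_ideal a \<mu> F f" and g: "g \<in> bicommutant"
  shows "bezout_ideal a \<mu> F (\<lambda>x. f (g x))"
proof -
  obtain Q V where QV: "\<And>l. l \<in> F \<Longrightarrow> Q l \<in> bicommutant" "V \<in> bicommutant"
    "\<And>x. f x = (\<Sum>l\<in>F. factor a l (Q l x)) + (T a (V x) - \<mu> *\<^sub>C V x)"
    using f unfolding bezout_ideal_def by blast
  show ?thesis
    unfolding bezout_ideal_def QV(3)
    using bicommutant_compose[OF QV(1) g] bicommutant_compose[OF QV(2) g]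
    by (intro exI[of _ "\<lambda>l x. Q l (g x)"] exI[of _ "\<lambda>x. V (g x)"]) simp
qed

lemma bezout_ideal_scaleC:
  assumes a: "a \<ge> 0" and f: "bezout_ideal a \<mu> F f"
  shows "bezout_ideal a \<mu> F (\<lambda>x. c *\<^sub>C f x)"
proof -
  obtain Q V where QV: "\<And>l. l \<in> F \<Longrightarrow> Q l \<in> bicommutant" "V \<in> bicommutant"
    "\<And>x. f x = (\<Sum>l\<in>F. factor a l (Q l x)) + (T a (V x) - \<mu> *\<^sub>C V x)"
    using f unfolding bezout_ideal_def by blast
  show ?thesis
    unfolding bezout_ideal_def
  proof (intro exI conjI ballI allI)
    show "(\<lambda>x. c *\<^sub>C Q l x) \<in> bicommutant" if "l \<in> F" for l
      using QV(1)[OF that] by (rule bicommutant_scaleC)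
    show "(\<lambda>x. c *\<^sub>C V x) \<in> bicommutant"
      using QV(2) by (rule bicommutant_scaleC)
    show "c *\<^sub>C f x = (\<Sum>l\<in>F. factor a l (c *\<^sub>C Q l x)) + (T a (c *\<^sub>C V x) - \<mu> *\<^sub>C c *\<^sub>C V x)" for x
      using a unfolding QV(3)
      by (simp add: bounded_clinear_scaleC[OF clinear_bicommutant[OF factor_bicommutant]]
          bounded_clinear_scaleC[OF clinear_T] scaleC_add_right complex_vector.scale_sum_right
          complex_vector.scale_right_diff_distrib scaleC_scaleC mult.commute)
  qed
qed

lemma bezout_ideal_multiple:
  assumes a: "a \<ge> 0" and V: "V \<in> bicommutant"
  shows "bezout_ideal a \<mu> F (\<lambda>x. T a (V x) - \<mu> *\<^sub>C V x)"
  unfolding bezout_ideal_def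
  using a by (intro exI[of _ "\<lambda>l x. 0"] exI[of _ V])
    (simp add: V zero_bicommutant bounded_clinear_0[OF clinear_bicommutant[OF factor_bicommutant]])

lemma bezout_ideal_factor:
  assumes a: "a \<ge> 0" and F: "finite F" "l \<in> F"
  shows "bezout_ideal a \<mu> F (factor a l)"
  unfolding bezout_ideal_def
proof (intro exI conjI ballI allI)
  show "(\<lambda>x. if k = l then x else 0) \<in> bicommutant" for k
    by (cases "k = l") (simp_all add: zero_bicommutant bicommutant_id)
  show "(\<lambda>x. 0) \<in> bicommutant" by (rule zero_bicommutant)
  have "factor a k (if k = l then x else 0) = (if k = l then factor a l x else 0)" for k x
    using a by (simp add: bounded_clinear_0[OF clinear_bicommutant[OF factor_bicommutant]])
  then show "factor a l x = (\<Sum>k\<in>F. factor a k (if k = l then x else 0)) + (T a 0 - \<mu> *\<^sub>C 0)" for x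
    using F by (simp add: bounded_clinear_0[OF clinear_T[OF a]])
qed

text \<open>For large \<open>l\<close> the operator \<open>1 - AT a / (l \<mu>)\<close> is invertible.\<close>

lemma factor_multiple:
  assumes a: "a > 0" and \<mu>: "exp (l * of_real a) = \<mu>"
    and K: "\<And>x. norm (AT a x) \<le> K * norm x" and l: "l \<noteq> 0" "2 * K \<le> cmod (l * \<mu>)"
  obtains V where "V \<in> bicommutant" "\<And>x. factor a l x = T a (V x) - \<mu> *\<^sub>C V x"
proof -
  have \<mu>0: "\<mu> \<noteq> 0" using \<mu> by auto
  let ?S = "shift (generator T) l" and ?U = "\<lambda>x. T a x - \<mu> *\<^sub>C x"
  let ?C = "orbit_integral a (\<lambda>s. of_real ((s - a) / a) * exp (- l * of_real s))"
  interpret operator_factorization ?S ?U "factor a l" ?C "1 / (a * \<mu>)"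
    by (rule operator_factorization_factor[OF a \<mu>])
  let ?f = "\<lambda>x. x - (1 / (l * \<mu>)) *\<^sub>C AT a x"
  have f: "?f \<in> bicommutant"
    by (intro bicommutant_diff bicommutant_scaleC bicommutant_id AT_bicommutant a)
  have small: "norm (x - ?f x) \<le> (1 / 2) * norm x" for x
  proof -
    have "cmod (l * \<mu>) > 0" using l \<mu>0 by simp
    have "norm (x - ?f x) = norm (AT a x) / cmod (l * \<mu>)"
      by (simp add: norm_scaleC norm_divide)
    also have "\<dots> \<le> K * norm x / cmod (l * \<mu>)"
      by (intro divide_right_mono K) simp
    also have "\<dots> \<le> (1 / 2) * norm x"
      using mult_right_mono[OF l(2) norm_ge_zero[of x]] \<open>cmod (l * \<mu>) > 0\<close> by (simp add: field_simps)
    finally show ?thesis .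
  qed
  obtain g where g: "g \<in> bicommutant" "\<And>x. ?f (g x) = x"
    by (rule bicommutant_inverse[OF f _ small]) (simp, rule that)
  \<comment> \<open>A right inverse of \<open>A - l\<close>: applied to
    \<open>l B y + T a y\<close>, where \<open>B\<close> is the factor, \<open>A - l\<close> gives
    \<open>l T a y - l \<mu> y + AT a y - l T a y\<close>. The \<open>T a\<close> terms cancel and
    \<open>- l \<mu>\<close> times \<open>?f y\<close> remains; with \<open>y = g x\<close> this is
    \<open>- l \<mu> x\<close>. Then \<open>B S \<subseteq> U\<close> gives
    \<open>B x = U (?W x)\<close>.\<close>
  let ?W = "\<lambda>x. (- 1 / (l * \<mu>)) *\<^sub>C (l *\<^sub>C factor a l (g x) + T a (g x))"
  have "?W \<in> bicommutant"
    using a by (intro bicommutant_scaleC bicommutant_add bicommutant_compose[OF _ g(1)]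
        factor_bicommutant T_bicommutant) auto
  moreover have "factor a l x = ?U (?W x)" for x
  proof -
    let ?y = "g x"
    have "(l *\<^sub>C factor a l ?y + T a ?y, l *\<^sub>C ?U ?y + (AT a ?y - l *\<^sub>C T a ?y)) \<in> ?S"
      using generator_T[OF a, of ?y]
      by (intro S_add S_scaleC SB) (simp add: shift_iff)
    then have "factor a l (l *\<^sub>C ?U ?y + (AT a ?y - l *\<^sub>C T a ?y)) = ?U (l *\<^sub>C factor a l ?y + T a ?y)"
      by (rule BS)
    also have "l *\<^sub>C ?U ?y + (AT a ?y - l *\<^sub>C T a ?y) = (- (l * \<mu>)) *\<^sub>C ?f ?y"
      using l \<mu>0 by (simp add: complex_vector.scale_right_diff_distrib scaleC_scaleC
          complex_vector.scale_minus_left scaleC_one)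
    also have "\<dots> = (- (l * \<mu>)) *\<^sub>C x" by (simp only: g(2))
    finally have "(- (l * \<mu>)) *\<^sub>C factor a l x = ?U (l *\<^sub>C factor a l ?y + T a ?y)"
      by (simp only: bounded_clinear_scaleC[OF clinear(2)])
    then have "(- 1 / (l * \<mu>)) *\<^sub>C (- (l * \<mu>)) *\<^sub>C factor a l x = ?U (?W x)"
      by (simp only: bounded_clinear_scaleC[OF clinear(1)])
    then show ?thesis
      using l \<mu>0 by (simp only: scaleC_scaleC) (simp add: scaleC_one)
  qed
  ultimately show thesis using that by blast
qed

text \<open>For \<open>h > 0\<close> the derivative at \<open>h + s\<close> is
  \<open>AT h (T s x)\<close>, bounded by a multiple of \<open>norm x\<close> uniformly in
  \<open>s\<close>. The constant does not depend on \<open>x\<close>, which makes this an estimate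
  in operator norm.\<close>

lemma orbit_Lipschitz:
  assumes a: "a > 0" and h: "h > 0"
  obtains K where "K \<ge> 0" "\<And>s r x. s \<in> {0..a} \<Longrightarrow> r \<in> {0..a} \<Longrightarrow>
    norm (exp (- l * of_real s) *\<^sub>C T (h + s) x - exp (- l * of_real r) *\<^sub>C T (h + r) x)
      \<le> K * norm x * \<bar>s - r\<bar>"
proof -
  let ?e = "\<lambda>s. exp (- l * complex_of_real s)"
  obtain M where M: "M > 0" "\<And>s x. 0 \<le> s \<Longrightarrow> s \<le> h + a \<Longrightarrow> norm (T s x) \<le> M * norm x"
    using bounded_T by blast
  obtain L where L: "L > 0" "\<And>x. norm (AT h x) \<le> L * norm x"
    using bounded_linear.pos_bounded[OF bounded_clinear_imp_bounded_linear[OF clinear_AT[OF h]]]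
    by (metis mult.commute)
  define m where "m = exp (cmod l * a)"
  have e: "cmod (?e s) \<le> m" if "s \<in> {0..a}" for s
  proof -
    have "cmod (?e s) = exp (- Re l * s)" by simp
    also have "- Re l * s \<le> cmod l * a"
      using that abs_Re_le_cmod[of l] by (intro mult_mono) auto
    finally show ?thesis by (simp add: m_def)
  qed
  have m: "m > 0" by (simp add: m_def)
  \<comment> \<open>The two terms of the product rule, with \<open>m\<close> bounding the
    exponential, \<open>L\<close> bounding \<open>AT h\<close> and \<open>M\<close> bounding the
    semigroup on \<open>[0, h + a]\<close>.\<close>
  define K where "K = m * (L * M) + cmod l * m * M"
  have K: "K \<ge> 0"
    unfolding K_def using m L(1) M(1) by (intro add_nonneg_nonneg mult_nonneg_nonneg) auto
  have "norm (?e s *\<^sub>C T (h + s) x - ?e r *\<^sub>C T (h + r) x) \<le> (K * norm x) * norm (s - r)"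
    if "s \<in> {0..a}" "r \<in> {0..a}" for s r x
  proof (rule differentiable_bound[of "{0..a}"])
    fix u assume u: "u \<in> {0..a}"
    let ?D = "?e u *\<^sub>C AT (h + u) x + (- l * ?e u) *\<^sub>C T (h + u) x"
    have "((\<lambda>s. ?e s *\<^sub>C T (h + s) x) has_vector_derivative ?D) (at u within {0..a})"
      using h u by (intro has_vector_derivative_at_within[OF
            bounded_bilinear.has_vector_derivative[OF bounded_bilinear_scaleC
              exp_weight_has_vector_derivative shifted_orbit_has_vector_derivative]]) auto
    then show "((\<lambda>s. ?e s *\<^sub>C T (h + s) x) has_derivative (\<lambda>v. v *\<^sub>R ?D)) (at u within {0..a})"
      by (simp add: has_vector_derivative_def)
    have "norm ?D \<le> norm (?e u *\<^sub>C AT (h + u) x) + norm ((- l * ?e u) *\<^sub>C T (h + u) x)"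
      by (rule norm_triangle_ineq)
    also have "\<dots> \<le> m * (L * (M * norm x)) + (cmod l * m) * (M * norm x)"
    proof (rule add_mono)
      have "norm (AT (h + u) x) \<le> L * norm (T u x)"
        using L(2)[of "T u x"] AT_T[OF h, of u x] u by simp
      also have "\<dots> \<le> L * (M * norm x)"
        using M(2)[of u x] L(1) u h by (intro mult_left_mono) auto
      finally show "norm (?e u *\<^sub>C AT (h + u) x) \<le> m * (L * (M * norm x))"
        unfolding norm_scaleC using e[OF u] m by (intro mult_mono) auto
      show "norm ((- l * ?e u) *\<^sub>C T (h + u) x) \<le> (cmod l * m) * (M * norm x)"
        unfolding norm_scaleC norm_mult norm_minus_cancel
        using e[OF u] m M(2)[of "h + u" x] u h by (intro mult_mono mult_nonneg_nonneg) auto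
    qed
    also have "\<dots> = K * norm x" by (simp add: K_def algebra_simps)
    finally have "norm ?D \<le> K * norm x" .
    then show "onorm (\<lambda>v. v *\<^sub>R ?D) \<le> K * norm x"
      by (intro onorm_le) (simp add: mult.commute mult_left_mono)
  qed (use that in auto)
  then show thesis using that[OF K] by simp
qed

text \<open>Modulo \<open>T a - \<mu>\<close>, the trigonometric polynomials of \<open>T\<close> over a period lie in the ideal of the
  factors; as the kernel concentrates at \<open>a / 2\<close>, they approximate a multiple of \<open>T (2 * a)\<close>, which is
  congruent to the invertible scalar \<open>\<mu>\<^sup>2\<close>.\<close>

lemma bezout_identity:
  assumes a: "a > 0" and \<mu>: "\<mu> \<noteq> 0"
  obtains F Q V where "finite F" "\<And>l. l \<in> F \<Longrightarrow> exp (l * of_real a) = \<mu>"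
    "\<And>l. l \<in> F \<Longrightarrow> Q l \<in> bicommutant" "V \<in> bicommutant"
    "\<And>x. (\<Sum>l\<in>F. factor a l (Q l x)) + (T a (V x) - \<mu> *\<^sub>C V x) = x"
proof -
  have a0: "a \<ge> 0" using a by simp
  define lam where "lam k = (Ln \<mu> + 2 * pi * \<i> * of_int k) / of_real a" for k :: int
  have exp_lam: "exp (lam k * of_real a) = \<mu>" for k
  proof -
    have "lam k * of_real a = Ln \<mu> + (2 * pi * of_int k) * \<i>"
      using a by (simp add: lam_def)
    then show ?thesis
      using \<mu> exp_plus_2pin[of "Ln \<mu>" k] by (simp add: mult_ac)
  qed
  obtain K where K: "\<And>x. norm (AT a x) \<le> K * norm x"
    using bounded_linear.bounded[OF bounded_clinear_imp_bounded_linear[OF clinear_AT[OF a]]]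
    by (metis mult.commute)
  \<comment> \<open>The threshold of \<open>factor_multiple\<close>: \<open>cmod l \<ge> R\<close>
    forces \<open>cmod (l * \<mu>) \<ge> 2 * K\<close>, and the added 1 forces
    \<open>l \<noteq> 0\<close>.\<close>
  define R where "R = 2 * \<bar>K\<bar> / cmod \<mu> + 1"
  \<comment> \<open>From \<open>a * cmod (lam k) \<ge> 2 pi \<bar>k\<bar> - cmod (Ln \<mu>)\<close>:
    every \<open>k\<close> beyond \<open>N\<close> has \<open>cmod (lam k) \<ge> R\<close>.\<close>
  define N where "N = \<lceil>a * R + cmod (Ln \<mu>)\<rceil>"
  have large: "R \<le> cmod (lam k)" if "N \<le> \<bar>k\<bar>" for k
  proof -
    have "a * R + cmod (Ln \<mu>) \<le> real_of_int \<bar>k\<bar>"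
      using that unfolding N_def by linarith
    also have "\<dots> \<le> 2 * pi * real_of_int \<bar>k\<bar>"
      using pi_ge_two by (intro mult_right_mono[of 1 "2 * pi", simplified]) auto
    also have "\<dots> = cmod (2 * pi * \<i> * of_int k)"
      by (simp add: norm_mult)
    also have "\<dots> \<le> cmod (Ln \<mu> + 2 * pi * \<i> * of_int k) + cmod (Ln \<mu>)"
      using norm_triangle_ineq4[of "Ln \<mu> + 2 * pi * \<i> * of_int k" "Ln \<mu>"] by simp
    finally have "R * a \<le> cmod (Ln \<mu> + 2 * pi * \<i> * of_int k)" by (simp add: mult.commute)
    then show ?thesis using a by (simp add: lam_def norm_divide field_simps)
  qed
  define F where "F = lam ` {- N..N}"
  have F: "finite F" by (simp add: F_def)
  have ideal_factor: "bezout_ideal a \<mu> F (factor a (lam k))" for k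
  proof (cases "\<bar>k\<bar> \<le> N")
    case True
    then show ?thesis
      by (intro bezout_ideal_factor[OF a0 F]) (simp add: F_def abs_le_iff)
  next
    case False
    then have R: "R \<le> cmod (lam k)" by (intro large) simp
    have "R > 0" unfolding R_def by (simp add: add_nonneg_pos)
    then have "lam k \<noteq> 0" using R by auto
    moreover have "2 * K \<le> cmod (lam k * \<mu>)"
    proof -
      have "2 * K \<le> 2 * \<bar>K\<bar> + cmod \<mu>" by (smt (verit) norm_ge_zero)
      also have "\<dots> = R * cmod \<mu>" using \<mu> by (simp add: R_def distrib_right)
      also have "\<dots> \<le> cmod (lam k) * cmod \<mu>" using R by (intro mult_right_mono) auto
      finally show ?thesis by (simp add: norm_mult)
    qed
    ultimately obtain V where "V \<in> bicommutant" "\<And>x. factor a (lam k) x = T a (V x) - \<mu> *\<^sub>C V x"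
      using factor_multiple[OF a exp_lam K] by blast
    then show ?thesis
      using bezout_ideal_multiple[OF a0, of V \<mu> F] by presburger
  qed
  define \<phi> where "\<phi> n k s = of_real (sin (pi * s / a) ^ (2 * n)) * exp (- lam k * complex_of_real s)" for n k s
  have cont: "continuous_on {0..a} (\<phi> n k)" for n k
    unfolding \<phi>_def by (intro continuous_intros) (use a in auto)
  \<comment> \<open>The frequency \<open>k\<close> must be general, because raising \<open>n\<close>
    by one brings in the neighbours \<open>k - 1\<close> and \<open>k + 1\<close>, possibly outside
    \<open>F\<close>; \<open>ideal_factor\<close> covers all of them.\<close>
  have ideal_\<phi>: "bezout_ideal a \<mu> F (orbit_integral a (\<phi> n k))" for n k
  proof (induction n arbitrary: k)
    case 0
    have "\<phi> 0 k = (\<lambda>s. exp (- lam k * complex_of_real s))"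
      by (simp add: \<phi>_def fun_eq_iff)
    then have "orbit_integral a (\<phi> 0 k) = (\<lambda>x. (1 / \<mu>) *\<^sub>C factor a (lam k) x)"
      using \<mu> by (intro ext) (simp add: factor_def exp_lam scaleC_scaleC scaleC_one)
    then show ?case using bezout_ideal_scaleC[OF a0 ideal_factor] by presburger
  next
    case (Suc n)
    have "\<phi> (Suc n) k s = (1 / 2) * \<phi> n k s + (- 1 / 4) * (\<phi> n (k + 1) s + \<phi> n (k - 1) s)" for s
    proof -
      have exps: "exp (- lam (k + 1) * complex_of_real s) =
          exp (- lam k * of_real s) * exp (- (2 * \<i> * of_real (pi * s / a)))"
        "exp (- lam (k - 1) * complex_of_real s) =
          exp (- lam k * of_real s) * exp (2 * \<i> * of_real (pi * s / a))"
        unfolding exp_add[symmetric] lam_def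
        by (simp_all add: algebra_simps add_divide_distrib diff_divide_distrib)
      have "complex_of_real (sin (pi * s / a) ^ (2 * Suc n)) =
          of_real (sin (pi * s / a) ^ (2 * n)) * of_real ((sin (pi * s / a))\<^sup>2)"
        by (simp add: power2_eq_square)
      then show ?thesis
        unfolding \<phi>_def exps of_real_sin_squared by (simp only:) (simp only: algebra_simps)
    qed
    then have "\<phi> (Suc n) k = (\<lambda>s. (1 / 2) * \<phi> n k s + (- 1 / 4) * (\<phi> n (k + 1) s + \<phi> n (k - 1) s))"
      by blast
    moreover have "orbit_integral a (\<lambda>s. (1 / 2) * \<phi> n k s + (- 1 / 4) * (\<phi> n (k + 1) s + \<phi> n (k - 1) s)) x =
        (1 / 2) *\<^sub>C orbit_integral a (\<phi> n k) x
        + (- 1 / 4) *\<^sub>C (orbit_integral a (\<phi> n (k + 1)) x + orbit_integral a (\<phi> n (k - 1)) x)" for x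
    proof -
      note c = continuous_on_mult[OF continuous_on_const] continuous_on_add cont
      show ?thesis
        by (subst orbit_integral_add, intro c, intro c)
          (simp only: orbit_integral_scale[OF cont] orbit_integral_scale[OF continuous_on_add[OF cont cont]]
            orbit_integral_add[OF cont cont])
    qed
    ultimately have "orbit_integral a (\<phi> (Suc n) k) = (\<lambda>x. (1 / 2) *\<^sub>C orbit_integral a (\<phi> n k) x
        + (- 1 / 4) *\<^sub>C (orbit_integral a (\<phi> n (k + 1)) x + orbit_integral a (\<phi> n (k - 1)) x))"
      by (intro ext) (simp only:)
    then show ?case
      using bezout_ideal_add[OF a0 bezout_ideal_scaleC[OF a0 Suc.IH]
          bezout_ideal_scaleC[OF a0 bezout_ideal_add[OF a0 Suc.IH Suc.IH]]] by presburger
  qed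
  \<comment> \<open>The shift keeps all times positive, so that the orbit is Lipschitz in norm, and
    places the kernel's centre \<open>s = a / 2\<close> at time \<open>2 * a\<close>.\<close>
  define h where "h s x = exp (- lam 0 * complex_of_real s) *\<^sub>C T (3 * a / 2 + s) x" for s x
  obtain L where L: "L \<ge> 0" "\<And>s r x. s \<in> {0..a} \<Longrightarrow> r \<in> {0..a} \<Longrightarrow>
      norm (h s x - h r x) \<le> L * norm x * \<bar>s - r\<bar>"
    unfolding h_def using orbit_Lipschitz[OF a, of "3 * a / 2" "lam 0"] a by auto
  define e where "e = exp (- lam 0 * complex_of_real (a / 2))"
  have e: "e * \<mu>\<^sup>2 \<noteq> 0" using \<mu> by (simp add: e_def)
  \<comment> \<open>Makes the relative error
    \<open>L * \<epsilon> * c / cmod (c * e * \<mu>\<^sup>2)\<close> at most \<open>1 / 2\<close>;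
    \<open>L + 1\<close> guards against \<open>L = 0\<close>.\<close>
  define \<epsilon> where "\<epsilon> = cmod (e * \<mu>\<^sup>2) / (2 * (L + 1))"
  have \<epsilon>: "\<epsilon> > 0" unfolding \<epsilon>_def using e L(1) by (intro divide_pos_pos) auto
  obtain n where n: "integral {0..a} (\<lambda>s. sin (pi * s / a) ^ (2 * n)) > 0"
    "integral {0..a} (\<lambda>s. sin (pi * s / a) ^ (2 * n) * \<bar>s - a / 2\<bar>)
      \<le> \<epsilon> * integral {0..a} (\<lambda>s. sin (pi * s / a) ^ (2 * n))"
    by (rule sin_power_concentrates[OF a \<epsilon>])
  define \<psi> where "\<psi> = (\<lambda>s. sin (pi * s / a) ^ (2 * n))"
  define c where "c = integral {0..a} \<psi>"
  have c: "c > 0" "integral {0..a} (\<lambda>s. \<psi> s * \<bar>s - a / 2\<bar>) \<le> \<epsilon> * c"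
    using n by (simp_all add: c_def \<psi>_def)
  have cont_\<psi>: "continuous_on {0..a} \<psi>"
    unfolding \<psi>_def by (intro continuous_intros) (use a in auto)
  have cont_h: "continuous_on {0..a} (\<lambda>s. h s x)" for x
    unfolding h_def using a
    by (intro scaleC.continuous_on continuous_on_exp_weight
        continuous_on_compose2[OF continuous_on_orbit] continuous_intros) auto
  define G where "G x = T (3 * a / 2) (orbit_integral a (\<phi> n 0) x)" for x
  have h_mid: "h (a / 2) x = e *\<^sub>C T (2 * a) x" for x
    by (simp add: h_def e_def)
  have close: "norm (G x - (c * e) *\<^sub>C T (2 * a) x) \<le> (L * \<epsilon> * c) * norm x" for x
  proof -
    have "G x = integral {0..a} (\<lambda>s. \<phi> n 0 s *\<^sub>C T (3 * a / 2) (T s x))"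
      unfolding G_def using a by (intro clinear_orbit_integral cont clinear_T) simp
    also have "\<dots> = integral {0..a} (\<lambda>s. \<psi> s *\<^sub>R h s x)"
      using a by (intro integral_cong) (simp add: \<phi>_def \<psi>_def h_def scaleR_scaleC scaleC_scaleC T_add)
    finally have G: "G x = integral {0..a} (\<lambda>s. \<psi> s *\<^sub>R h s x)" .
    have "((\<lambda>s. \<psi> s *\<^sub>R h (a / 2) x) has_integral c *\<^sub>R h (a / 2) x) {0..a}"
      unfolding c_def by (intro has_integral_scaleR_left integrable_integral integrable_continuous_real cont_\<psi>)
    then have "(c * e) *\<^sub>C T (2 * a) x = integral {0..a} (\<lambda>s. \<psi> s *\<^sub>R h (a / 2) x)"
      by (simp add: integral_unique h_mid scaleR_scaleC scaleC_scaleC)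
    with G have "G x - (c * e) *\<^sub>C T (2 * a) x =
        integral {0..a} (\<lambda>s. \<psi> s *\<^sub>R h s x) - integral {0..a} (\<lambda>s. \<psi> s *\<^sub>R h (a / 2) x)"
      by simp
    also have "\<dots> = integral {0..a} (\<lambda>s. \<psi> s *\<^sub>R h s x - \<psi> s *\<^sub>R h (a / 2) x)"
      by (intro integral_diff[symmetric] integrable_continuous_real continuous_intros cont_\<psi> cont_h)
    also have "norm \<dots> \<le> integral {0..a} (\<lambda>s. (L * norm x) * (\<psi> s * \<bar>s - a / 2\<bar>))"
    proof (rule integral_norm_bound_integral)
      show "(\<lambda>s. \<psi> s *\<^sub>R h s x - \<psi> s *\<^sub>R h (a / 2) x) integrable_on {0..a}"
        by (intro integrable_continuous_real continuous_intros cont_\<psi> cont_h)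
      show "(\<lambda>s. (L * norm x) * (\<psi> s * \<bar>s - a / 2\<bar>)) integrable_on {0..a}"
        by (intro integrable_continuous_real continuous_intros cont_\<psi>)
      fix s assume s: "s \<in> {0..a}"
      have "\<psi> s \<ge> 0" by (simp add: \<psi>_def)
      have "norm (\<psi> s *\<^sub>R h s x - \<psi> s *\<^sub>R h (a / 2) x) = \<psi> s * norm (h s x - h (a / 2) x)"
        using \<open>\<psi> s \<ge> 0\<close> by (simp flip: scaleR_diff_right)
      also have "\<dots> \<le> \<psi> s * (L * norm x * \<bar>s - a / 2\<bar>)"
        using \<open>\<psi> s \<ge> 0\<close> s a by (intro mult_left_mono L) auto
      finally show "norm (\<psi> s *\<^sub>R h s x - \<psi> s *\<^sub>R h (a / 2) x) \<le> (L * norm x) * (\<psi> s * \<bar>s - a / 2\<bar>)"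
        by (simp add: mult_ac)
    qed
    also have "\<dots> = (L * norm x) * integral {0..a} (\<lambda>s. \<psi> s * \<bar>s - a / 2\<bar>)"
      by (rule integral_mult_right)
    also have "\<dots> \<le> (L * norm x) * (\<epsilon> * c)"
      using L(1) by (intro mult_left_mono c) simp
    finally show ?thesis by (simp add: mult_ac)
  qed
  \<comment> \<open>The cofactor in
    \<open>T (2 a) - \<mu>^2 = (T a - \<mu>) (T a + \<mu>)\<close>.\<close>
  define W where "W x = T a x + \<mu> *\<^sub>C x" for x
  have W: "W \<in> bicommutant"
    unfolding W_def using a by (intro bicommutant_add bicommutant_scaleC bicommutant_id T_bicommutant) simp
  have UW: "T a (W x) - \<mu> *\<^sub>C W x = T (2 * a) x - \<mu>\<^sup>2 *\<^sub>C x" for x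
    using a T_add[of a a x]
    by (simp add: W_def bounded_clinear_simps[OF clinear_T] scaleC_add_right scaleC_scaleC power2_eq_square)
  \<comment> \<open>\<open>G\<close> is close to \<open>c e T (2 a)\<close>. Subtracting a multiple
    of \<open>T a - \<mu>\<close> replaces this by the scalar \<open>c e \<mu>^2\<close> without
    leaving the ideal, and the prefactor normalises the scalar to 1.\<close>
  define f where "f x = (1 / (c * e * \<mu>\<^sup>2)) *\<^sub>C (G x + (- (c * e)) *\<^sub>C (T a (W x) - \<mu> *\<^sub>C W x))" for x
  have T3: "T (3 * a / 2) \<in> bicommutant" using a by (intro T_bicommutant) simp
  have "orbit_integral a (\<phi> n 0) \<in> bicommutant"
    using cont a0 by (rule orbit_integral_bicommutant)
  note E = this
  have f_bicommutant: "f \<in> bicommutant"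
  proof -
    have "G \<in> bicommutant" unfolding G_def by (rule bicommutant_compose[OF T3 E])
    moreover have "(\<lambda>x. T a (W x)) \<in> bicommutant"
      by (rule bicommutant_compose[OF T_bicommutant[OF a0] W])
    ultimately show ?thesis
      unfolding f_def using W by (intro bicommutant_scaleC bicommutant_add bicommutant_diff)
  qed
  have f_ideal: "bezout_ideal a \<mu> F f"
  proof -
    have "G = (\<lambda>x. orbit_integral a (\<phi> n 0) (T (3 * a / 2) x))"
      unfolding G_def using bicommutant_commute[OF T3 E] by blast
    then have "bezout_ideal a \<mu> F G"
      using bezout_ideal_compose[OF ideal_\<phi> T3] by presburger
    then show ?thesis
      unfolding f_def by (intro bezout_ideal_scaleC bezout_ideal_add bezout_ideal_multiple a0 W)
  qed
  have small: "norm (x - f x) \<le> (1 / 2) * norm x" for x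
  proof -
    let ?d = "c * e * \<mu>\<^sup>2"
    have d: "?d \<noteq> 0" using c e by simp
    have "f x = (1 / ?d) *\<^sub>C (G x - (c * e) *\<^sub>C T (2 * a) x + ?d *\<^sub>C x)"
      unfolding f_def UW
      by (simp add: complex_vector.scale_right_diff_distrib scaleC_scaleC complex_vector.scale_minus_left mult.assoc)
    also have "\<dots> = (1 / ?d) *\<^sub>C (G x - (c * e) *\<^sub>C T (2 * a) x) + x"
      using d by (simp add: scaleC_add_right scaleC_scaleC scaleC_one)
    finally have "norm (x - f x) = norm (G x - (c * e) *\<^sub>C T (2 * a) x) / cmod ?d"
      by (simp add: norm_scaleC norm_divide)
    also have "\<dots> \<le> (L * \<epsilon> * c) * norm x / cmod ?d"
      by (intro divide_right_mono close) simp
    also have "\<dots> \<le> (1 / 2) * norm x"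
    proof -
      have "L * \<epsilon> \<le> cmod (e * \<mu>\<^sup>2) / 2"
        using L(1) by (simp add: \<epsilon>_def field_simps mult_left_mono)
      then have "L * \<epsilon> * c \<le> cmod ?d / 2"
        using mult_right_mono[of "L * \<epsilon>" "cmod (e * \<mu>\<^sup>2) / 2" c] c(1) by (simp add: norm_mult mult_ac)
      then have "(L * \<epsilon> * c) * norm x \<le> cmod ?d / 2 * norm x"
        by (rule mult_right_mono) simp
      moreover have "cmod ?d > 0" using d by (simp only: zero_less_norm_iff not_False_eq_True)
      ultimately show ?thesis by (simp add: pos_divide_le_eq mult_ac)
    qed
    finally show ?thesis .
  qed
  obtain g where g: "g \<in> bicommutant" "\<And>x. f (g x) = x"
    by (rule bicommutant_inverse[OF f_bicommutant _ small]) (simp, rule that)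
  then have "bezout_ideal a \<mu> F (\<lambda>x. x)"
    using bezout_ideal_compose[OF f_ideal g(1)] by simp
  then obtain Q V where "\<And>l. l \<in> F \<Longrightarrow> Q l \<in> bicommutant" "V \<in> bicommutant"
    "\<And>x. x = (\<Sum>l\<in>F. factor a l (Q l x)) + (T a (V x) - \<mu> *\<^sub>C V x)"
    unfolding bezout_ideal_def by blast
  moreover have "exp (l * of_real a) = \<mu>" if "l \<in> F" for l
    using that exp_lam by (auto simp: F_def)
  ultimately show thesis using that[OF F] by metis
qed

section \<open>The spectral mapping theorem\<close>

lemma shift_op_graph: "shift (op_graph f) \<mu> = op_graph (\<lambda>x. f x - \<mu> *\<^sub>C x)"
  by (auto simp: shift_def op_graph_def)

text \<open>The five properties are the atoms of all six spectra. A conjunction of statements of the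
  form "for every \<open>l\<close> in the fibre" has that form again, so treating each atom alone is
  enough. From right to left only the finitely many \<open>l\<close> in \<open>F\<close> are
  consulted.\<close>

lemma property_transfer:
  assumes a: "a > 0" and \<mu>: "\<mu> \<noteq> 0"
  defines "A \<equiv> generator T" and "U \<equiv> shift (op_graph (T a)) \<mu>"
  shows "finite_dimensional (null_space U) \<longleftrightarrow>
      (\<forall>l. exp (l * of_real a) = \<mu> \<longrightarrow> finite_dimensional (null_space (shift A l)))"
    and "closed (Range U) \<longleftrightarrow> (\<forall>l. exp (l * of_real a) = \<mu> \<longrightarrow> closed (Range (shift A l)))"
    and "finite_codimensional (Range U) \<longleftrightarrow>
      (\<forall>l. exp (l * of_real a) = \<mu> \<longrightarrow> finite_codimensional (Range (shift A l)))"
    and "ascent U < \<infinity> \<longleftrightarrow> (\<forall>l. exp (l * of_real a) = \<mu> \<longrightarrow> ascent (shift A l) < \<infinity>)"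
    and "descent U < \<infinity> \<longleftrightarrow> (\<forall>l. exp (l * of_real a) = \<mu> \<longrightarrow> descent (shift A l) < \<infinity>)"
proof -
  let ?U = "\<lambda>x. T a x - \<mu> *\<^sub>C x"
  let ?C = "\<lambda>l. orbit_integral a (\<lambda>s. of_real ((s - a) / a) * exp (- l * of_real s))"
  have a0: "a \<ge> 0" using a by simp
  have U: "U = op_graph ?U" unfolding U_def by (rule shift_op_graph)
  have factorization: "operator_factorization (shift A l) ?U (factor a l) (?C l) (1 / (a * \<mu>))"
    if "exp (l * of_real a) = \<mu>" for l
    unfolding A_def using operator_factorization_factor[OF a that] .
  obtain F Q V where FQV: "finite F" "\<And>l. l \<in> F \<Longrightarrow> exp (l * of_real a) = \<mu>"
    "\<And>l. l \<in> F \<Longrightarrow> Q l \<in> bicommutant" "V \<in> bicommutant"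
    "\<And>x. (\<Sum>l\<in>F. factor a l (Q l x)) + (T a (V x) - \<mu> *\<^sub>C V x) = x"
    by (rule bezout_identity[OF a \<mu>]) (rule that)
  have U_bicommutant: "?U \<in> bicommutant"
    using a0 by (intro bicommutant_diff T_bicommutant bicommutant_scaleC bicommutant_id)
  have bezout: "bezout_factorization F (shift A) ?U (factor a) ?C Q (\<lambda>l. 1 / (a * \<mu>)) V"
  proof (rule bezout_factorization.intro)
    show "Q l (factor a l x) = factor a l (Q l x)" if "l \<in> F" for l x
      by (rule bicommutant_commute[OF FQV(3)[OF that] factor_bicommutant[OF a0]])
    show "Q l (?U x) = ?U (Q l x)" if "l \<in> F" for l x
      by (rule bicommutant_commute[OF FQV(3)[OF that] U_bicommutant])
    show "V (?U x) = ?U (V x)" for x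
      by (rule bicommutant_commute[OF FQV(4) U_bicommutant])
  qed (rule FQV(1,5) factorization[OF FQV(2)] clinear_bicommutant[OF U_bicommutant]
      clinear_bicommutant[OF FQV(3)] clinear_bicommutant[OF FQV(4)]; assumption)+
  show "finite_dimensional (null_space U) \<longleftrightarrow>
      (\<forall>l. exp (l * of_real a) = \<mu> \<longrightarrow> finite_dimensional (null_space (shift A l)))"
    unfolding U using operator_factorization.finite_dimensional_null_space[OF factorization]
      bezout_factorization.finite_dimensional_null_space[OF bezout] FQV(2) by blast
  show "closed (Range U) \<longleftrightarrow> (\<forall>l. exp (l * of_real a) = \<mu> \<longrightarrow> closed (Range (shift A l)))"
    unfolding U using operator_factorization.closed_Range[OF factorization]
      bezout_factorization.closed_Range[OF bezout] FQV(2) by blast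
  show "finite_codimensional (Range U) \<longleftrightarrow>
      (\<forall>l. exp (l * of_real a) = \<mu> \<longrightarrow> finite_codimensional (Range (shift A l)))"
    unfolding U using operator_factorization.finite_codimensional_Range[OF factorization]
      bezout_factorization.finite_codimensional_Range[OF bezout] FQV(2) by blast
  show "ascent U < \<infinity> \<longleftrightarrow> (\<forall>l. exp (l * of_real a) = \<mu> \<longrightarrow> ascent (shift A l) < \<infinity>)"
    unfolding U using operator_factorization.ascent_finite[OF factorization]
      bezout_factorization.ascent_finite[OF bezout] FQV(2) by blast
  show "descent U < \<infinity> \<longleftrightarrow> (\<forall>l. exp (l * of_real a) = \<mu> \<longrightarrow> descent (shift A l) < \<infinity>)"
    unfolding U using operator_factorization.descent_finite[OF factorization]
      bezout_factorization.descent_finite[OF bezout] FQV(2) by blast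
qed

end

text \<open>Negating "for every preimage" gives "for some preimage", hence the image under the
  exponential. That image avoids 0, which matches the removal of 0 on the left.\<close>

lemma spectral_mappingI:
  assumes "\<And>\<mu>. \<mu> \<noteq> 0 \<Longrightarrow>
    P (shift S \<mu>) \<longleftrightarrow> (\<forall>l. exp (l * complex_of_real t) = \<mu> \<longrightarrow> P (shift A l))"
  shows "{\<mu>. \<not> P (shift S \<mu>)} - {0} = {exp (l * complex_of_real t) | l. l \<in> {l. \<not> P (shift A l)}}"
  using assms by auto

theorem corollary2:
  fixes T :: "real \<Rightarrow> 'a::complex_banach \<Rightarrow> 'a"
    and A :: "'a operator"
    and t :: real
    and \<sigma> :: "'a operator \<Rightarrow> complex set"
  assumes "differentiable_semigroup T"
    and "A = generator T"
    and "t > 0"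
    and "\<sigma> \<in> {sigma_uf, sigma_lf, sigma_e, sigma_ub, sigma_lb, sigma_b}"
  shows "\<sigma> (op_graph (T t)) - {0} = {exp (l * complex_of_real t) | l. l \<in> \<sigma> A}"
proof -
  interpret diff_semigroup T using assms(1) by unfold_locales
  note transfer = property_transfer[OF assms(3)]
  note mapping = spectral_mappingI[of _ "op_graph (T t)" t A]
  note uf = upper_semi_Fredholm_def and lf = lower_semi_Fredholm_def
  have uf_iff: "upper_semi_Fredholm (shift (op_graph (T t)) \<mu>) \<longleftrightarrow>
      (\<forall>l. exp (l * complex_of_real t) = \<mu> \<longrightarrow> upper_semi_Fredholm (shift A l))"
    and lf_iff: "lower_semi_Fredholm (shift (op_graph (T t)) \<mu>) \<longleftrightarrow>
      (\<forall>l. exp (l * complex_of_real t) = \<mu> \<longrightarrow> lower_semi_Fredholm (shift A l))"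
    if "\<mu> \<noteq> 0" for \<mu>
    unfolding uf lf transfer[OF that] assms(2) by blast+
  have e_iff: "Fredholm (shift (op_graph (T t)) \<mu>) \<longleftrightarrow>
      (\<forall>l. exp (l * complex_of_real t) = \<mu> \<longrightarrow> Fredholm (shift A l))"
    and ub_iff: "upper_semi_Browder (shift (op_graph (T t)) \<mu>) \<longleftrightarrow>
      (\<forall>l. exp (l * complex_of_real t) = \<mu> \<longrightarrow> upper_semi_Browder (shift A l))"
    and lb_iff: "lower_semi_Browder (shift (op_graph (T t)) \<mu>) \<longleftrightarrow>
      (\<forall>l. exp (l * complex_of_real t) = \<mu> \<longrightarrow> lower_semi_Browder (shift A l))"
    if "\<mu> \<noteq> 0" for \<mu>
    unfolding Fredholm_def upper_semi_Browder_def lower_semi_Browder_def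
      uf_iff[OF that] lf_iff[OF that] transfer(4,5)[OF that] assms(2) by blast+
  have b_iff: "Browder (shift (op_graph (T t)) \<mu>) \<longleftrightarrow>
      (\<forall>l. exp (l * complex_of_real t) = \<mu> \<longrightarrow> Browder (shift A l))"
    if "\<mu> \<noteq> 0" for \<mu>
    unfolding Browder_def ub_iff[OF that] lb_iff[OF that] by blast
  from assms(4) show ?thesis
    using mapping[OF uf_iff] mapping[OF lf_iff] mapping[OF e_iff] mapping[OF ub_iff]
      mapping[OF lb_iff] mapping[OF b_iff]
    unfolding sigma_uf_def[abs_def] sigma_lf_def[abs_def] sigma_e_def[abs_def]
      sigma_ub_def[abs_def] sigma_lb_def[abs_def] sigma_b_def[abs_def]
    by auto
qed

end
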